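(* For any Hamiltonian graph $\Gamma_{n+1}$ on $[n+1]$ and all indices $i$ in the respective ranges: 1) $\gamma_i(Cy^n)\le\gamma_i(P_{\Gamma_{n+1}})\le\gamma_i(Pe^n)$ for $0\le i\le\lfloor n/2\rfloor$; 2) $g_i(Cy^n)\le g_i(P_{\Gamma_{n+1}})\le g_i(Pe^n)$ for $0\le i\le\lfloor n/2\rfloor$; 3) $h_i(Cy^n)\le h_i(P_{\Gamma_{n+1}})\le h_i(Pe^n)$ for $0\le i\le n$; 4) $f_i(Cy^n)\le f_i(P_{\Gamma_{n+1}})\le f_i(Pe^n)$ for $0\le i\le n$.
   Context: Notation: $[m]=\{1,\ldots,m\}$. Graphs are finite, with no loops or multiple edges. A graph is Hamiltonian if it contains a Hamiltonian cycle, i.e. a cycle visiting each vertex exactly once (so it has at least 3 vertices). For a graph $\Gamma$ on $[n+1]$, the graphical building set $B(\Gamma)$ is the collection of nonempty $S\subseteq[n+1]$ such that the induced subgraph $\Gamma|_S$ is connected. The graph-associahedron is the Minkowski sum $P_\Gamma=\sum_{S\in B(\Gamma)}\Delta^S\subset\mathbb{R}^{n+1}$, where $\Delta^S=\mathrm{conv}\{e_i : i\in S\}$ and $e_1,\ldots,e_{n+1}$ are the standard basis vectors of $\mathbb{R}^{n+1}$. For connected $\Gamma$ on $[n+1]$, $P_\Gamma$ is a simple polytope of dimension $n$ (a polytope of dimension $n$ is simple if every vertex lies in exactly $n$ facets). Special series: $Cy^n=P_{C_{n+1}}$ (cyclohedron), $C_{n+1}$ the cycle graph on $[n+1]$; $Pe^n=P_{K_{n+1}}$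 (permutohedron), $K_{n+1}$ the complete graph on $[n+1]$. For an $n$-dimensional simple polytope $P$, let $f_i=f_i(P)$ be the number of its $i$-dimensional faces ($f_n=1$), $F(P)(\alpha,t)=\sum_{i=0}^n f_i\alpha^i t^{n-i}$ and $H(P)(\alpha,t)=F(P)(\alpha-t,t)=\sum_{i=0}^n h_i\alpha^{n-i}t^i$, which defines $h_i=h_i(P)$. Put $g_0=1$ and $g_i=h_i-h_{i-1}$ for $1\le i\le\lfloor n/2\rfloor$. By the Dehn–Sommerville equations $H(P)$ is symmetric in $\alpha,t$, so it is uniquely written as $H(P)=\sum_{i=0}^{\lfloor n/2\rfloor}\gamma_i(\alpha t)^i(\alpha+t)^{n-2i}$, which defines $\gamma_i=\gamma_i(P)$. *)

theory Defs
  imports "HOL-Analysis.Analysis" "HOL-Computational_Algebra.Polynomial"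
    "Graph_Theory.Pair_Digraph" "Graph_Theory.Digraph_Component"
begin

text \<open>
  A finite simple graph is a \<^locale>\<open>pair_graph\<close>, that is a finite, loop-free, symmetric
  digraph whose arcs are pairs of vertices; the edge \<open>{u, v}\<close> is the pair of arcs \<open>(u, v)\<close>,
  \<open>(v, u)\<close>.
\<close>

definition cycle_graph :: "nat \<Rightarrow> nat pair_pre_digraph" where
  "cycle_graph m = \<lparr> pverts = {1..m},
     parcs = {(i, j). i \<in> {1..m} \<and> j \<in> {1..m} \<and> i \<noteq> j \<and>
       (j = Suc i \<or> i = Suc j \<or> {i, j} = {1, m})} \<rparr>"

definition complete_graph :: "nat \<Rightarrow> nat pair_pre_digraph" where
  "complete_graph m = \<lparr> pverts = {1..m},
     parcs = {(i, j). i \<in> {1..m} \<and> j \<in> {1..m} \<and> i \<noteq> j} \<rparr>"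

text \<open>
  The predicate \<^const>\<open>pre_digraph.cycle\<close> already says that no vertex is repeated. It also
  accepts \<open>u, v, u\<close>, which traverses both arcs of a single edge and is not a cycle of the
  graph; the length condition excludes this.
\<close>

definition hamiltonian :: "'v pair_pre_digraph \<Rightarrow> bool" where
  "hamiltonian G \<longleftrightarrow>
     (\<exists>p. pre_digraph.cycle (with_proj G) p \<and> 3 \<le> length p \<and> fst ` set p = pverts G)"

text \<open>
  The name \<open>connected\<close> is qualified to distinguish it from topological connectedness.
\<close>

definition graphical_building_set :: "'v pair_pre_digraph \<Rightarrow> 'v set set" where
  "graphical_building_set G =
     {S. S \<noteq> {} \<and> S \<subseteq> pverts G \<and> Digraph_Component.connected (with_proj G \<restriction> S)}"

text \<open>
  In the following, \<open>e i\<close> is the basis vector belonging to the vertex \<open>i\<close>. The sum is the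
  Minkowski sum of sets.
\<close>

definition graph_associahedron ::
  "('v \<Rightarrow> 'a::euclidean_space) \<Rightarrow> 'v pair_pre_digraph \<Rightarrow> 'a set" where
  "graph_associahedron e G = (\<Sum>S \<in> graphical_building_set G. convex hull (e ` S))"

definition cyclohedron :: "(nat \<Rightarrow> 'a::euclidean_space) \<Rightarrow> nat \<Rightarrow> 'a set" where
  "cyclohedron e n = graph_associahedron e (cycle_graph (n + 1))"

definition permutohedron :: "(nat \<Rightarrow> 'a::euclidean_space) \<Rightarrow> nat \<Rightarrow> 'a set" where
  "permutohedron e n = graph_associahedron e (complete_graph (n + 1))"

definition poly_dim :: "'a::euclidean_space set \<Rightarrow> nat" where
  "poly_dim P = nat (aff_dim P)"

definition f_num :: "'a::euclidean_space set \<Rightarrow> nat \<Rightarrow> nat" where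
  "f_num P i = card {F. F face_of P \<and> aff_dim F = int i}"

text \<open>
  Polynomials in \<open>\<alpha>\<close> and \<open>t\<close> are polynomials in the outer variable \<open>\<alpha>\<close> whose
  coefficients are polynomials in the inner variable \<open>t\<close>.
\<close>

definition var_\<alpha> :: "int poly poly" where
  "var_\<alpha> = [:0, 1:]"

definition var_t :: "int poly poly" where
  "var_t = [:[:0, 1:]:]"

definition F_poly :: "'a::euclidean_space set \<Rightarrow> int poly poly" where
  "F_poly P = (\<Sum>i\<le>poly_dim P. of_nat (f_num P i) * var_\<alpha> ^ i * var_t ^ (poly_dim P - i))"

definition H_poly :: "'a::euclidean_space set \<Rightarrow> int poly poly" where
  "H_poly P = pcompose (F_poly P) (var_\<alpha> - var_t)"

text \<open>The coefficient of \<open>\<alpha>\<^sup>n\<^sup>-\<^sup>i t\<^sup>i\<close> in \<open>H(P)\<close>, where \<open>n\<close> is the dimension of \<open>P\<close>.\<close>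

definition h_num :: "'a::euclidean_space set \<Rightarrow> nat \<Rightarrow> int" where
  "h_num P i = coeff (coeff (H_poly P) (poly_dim P - i)) i"

fun g_num :: "'a::euclidean_space set \<Rightarrow> nat \<Rightarrow> int" where
  "g_num P 0 = 1"
| "g_num P (Suc i) = h_num P (Suc i) - h_num P i"

text \<open>
  For a simple polytope, the Dehn-Sommerville equations make \<open>H(P)\<close> symmetric, which gives
  existence of the coefficients; uniqueness holds because the polynomials
  \<open>(\<alpha>t)\<^sup>i(\<alpha>+t)\<^sup>n\<^sup>-\<^sup>2\<^sup>i\<close> are linearly independent. The values outside the range are fixed to 0
  so that the whole sequence is unique.
\<close>

definition gamma_num :: "'a::euclidean_space set \<Rightarrow> nat \<Rightarrow> int" where
  "gamma_num P = (THE \<gamma>. (\<forall>i > poly_dim P div 2. \<gamma> i = 0) \<and>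
     H_poly P = (\<Sum>i\<le>poly_dim P div 2.
       of_int (\<gamma> i) * (var_\<alpha> * var_t) ^ i * (var_\<alpha> + var_t) ^ (poly_dim P - 2 * i)))"

end

theory Submission
  imports Defs
begin

text \<open>
  The comparison rests on reducing face numbers to a sum over preorders and on a formula for
  adding one edge to a graph.

  \<^bold>\<open>Faces are preorders.\<close> A linear functional on \<open>\<real>\<^sup>V\<close> is a weight \<open>w\<close> on the vertices. The face
  of a graph-associahedron on which it is maximal is the Minkowski sum of the simplices spanned
  by the \<open>w\<close>-maximal vertices of each connected set \<open>S\<close>. These sets of maximal vertices carry the
  same information as the preorder in which \<open>i\<close> lies below \<open>j\<close> if some path from \<open>i\<close> to \<open>j\<close> never
  exceeds the weight of \<open>j\<close>; so faces correspond to such preorders, and a preorder with \<open>k\<close>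
  blocks gives a face of dimension \<open>|V| - k\<close> (\<open>face_in_eq_iff\<close>, \<open>aff_dim_face_in\<close>). Hence the
  face polynomial of the polytope is a sum \<open>h_sum\<close> over preorders, one factor \<open>t\<close> for every
  block but one.

  \<^bold>\<open>Adding an edge.\<close> If \<open>U\<close> is connected, the top block of a preorder on \<open>U\<close> can be any nonempty
  subset, and below it any preorder on the rest may follow. This recursion (\<open>face_sum_linked\<close>)
  determines the sums \<open>face_sum\<close>, and checking it for the right-hand side proves the formula
  \<open>face_sum_add_edge\<close>. For a connected graph on \<open>V\<close> and a new edge \<open>uv\<close> it reads
  \<open>H' = H + \<alpha> t (\<Sum>S. H(S\<^sub>1) H(S\<^sub>2) H(V / S))\<close>, where \<open>S\<close> ranges over the proper subsets of \<open>V\<close> that the new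
  edge makes connected, \<open>S\<^sub>1\<close> and \<open>S\<^sub>2\<close> are the two components of \<open>S\<close> before, and \<open>V / S\<close> is the
  graph on the complement of \<open>S\<close> in which all neighbours of \<open>S\<close> are joined. Geometrically, the
  new polytope arises by cutting off one face of codimension 2 for every \<open>S\<close>. If the edge is a
  bridge between two components, the formula holds with \<open>(\<alpha> + t) H\<^sub>1 H\<^sub>2\<close> in place of \<open>H\<close>.

  \<^bold>\<open>Positivity.\<close> The polynomials with nonnegative gamma-vector are closed under sums and products
  and contain \<open>\<alpha> t\<close> and \<open>\<alpha> + t\<close>. Building a connected graph edge by edge therefore shows that its
  H-polynomial has a nonnegative gamma-vector (\<open>h_polynomial_gamma_nonneg\<close>), and then that the
  gamma-vector grows when edges are added (\<open>h_polynomial_mono\<close>). Each \<open>(\<alpha> t)\<^sup>i (\<alpha> + t)\<^sup>n\<^sup>-\<^sup>2\<^sup>i\<close> has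
  nonnegative coefficients that increase towards the middle, which gives the inequalities for the
  g- and h-numbers; the f-numbers are nonnegative combinations of the h-numbers
  (\<open>face_numbers_mono\<close>).

  A Hamiltonian graph lies between a relabelled cycle graph and the complete graph, and
  relabelling the vertices does not change the polytope up to permuting coordinates.
\<close>

section \<open>Facial preorders of a graph\<close>

definition linked :: "('v \<times> 'v) set \<Rightarrow> 'v set \<Rightarrow> bool" where
  "linked E U \<longleftrightarrow> (\<forall>a\<in>U. \<forall>b\<in>U. (a, b) \<in> (Restr E U)\<^sup>*)"

definition apart :: "('v \<times> 'v) set \<Rightarrow> 'v set \<Rightarrow> 'v set \<Rightarrow> bool" where
  "apart E A B \<longleftrightarrow> A \<inter> B = {} \<and> E \<inter> (A \<times> B \<union> B \<times> A) = {}"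

text \<open>
  In an undirected graph, \<open>i\<close> is below \<open>j\<close> exactly if some connected
  set contains \<open>i\<close> and has \<open>j\<close> among its heaviest vertices.
\<close>

definition facial_preorder :: "('v \<times> 'v) set \<Rightarrow> ('v \<Rightarrow> real) \<Rightarrow> 'v set \<Rightarrow> ('v \<times> 'v) set" where
  "facial_preorder E w U =
     {(i, j). i \<in> U \<and> j \<in> U \<and> (i, j) \<in> (Restr E {k\<in>U. w k \<le> w j})\<^sup>*}"

definition facial_preorders :: "('v \<times> 'v) set \<Rightarrow> 'v set \<Rightarrow> ('v \<times> 'v) set set" where
  "facial_preorders E U = range (\<lambda>w. facial_preorder E w U)"

definition blocks :: "('v \<times> 'v) set \<Rightarrow> 'v set \<Rightarrow> 'v set set" where
  "blocks c U = U // (c \<inter> c\<inverse>)"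

text \<open>
  On a connected set this is \<open>x\<close> times the face polynomial of the graph-associahedron. The extra
  factor \<open>x\<close> for each component makes the sum multiplicative over components.
\<close>

definition face_sum :: "'r::idom \<Rightarrow> 'r \<Rightarrow> ('v \<times> 'v) set \<Rightarrow> 'v set \<Rightarrow> 'r" where
  "face_sum x y E U = (\<Sum>c\<in>facial_preorders E U.
     x ^ card (blocks c U) * y ^ (card U - card (blocks c U)))"

lemma rtrancl_Restr_in:
  assumes "(a, b) \<in> (Restr E U)\<^sup>*" "a \<in> U" shows "b \<in> U"
  using assms by (induction rule: rtrancl_induct) auto

lemma rtrancl_Restr_mono:
  assumes "(a, b) \<in> (Restr E U)\<^sup>*" "Restr E U \<subseteq> Restr E' U'"
  shows "(a, b) \<in> (Restr E' U')\<^sup>*"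
  using assms rtrancl_mono by blast

lemma apart_commute: "apart E A B \<longleftrightarrow> apart E B A"
  by (auto simp: apart_def)

lemma apart_walk:
  assumes "(i, j) \<in> (Restr E Y)\<^sup>*" "apart E A B" "Y \<subseteq> A \<union> B" "i \<in> A"
  shows "j \<in> A \<and> (i, j) \<in> (Restr E (Y \<inter> A))\<^sup>*"
  using assms(1)
proof (induction rule: rtrancl_induct)
  case base
  then show ?case using assms by simp
next
  case (step k l)
  have "l \<in> A" using step assms(2,3) by (auto simp: apart_def)
  then have "(k, l) \<in> Restr E (Y \<inter> A)" using step by auto
  then show ?case using step.IH \<open>l \<in> A\<close> by (meson rtrancl.rtrancl_into_rtrancl)
qed

lemma linked_mono: "linked E U \<Longrightarrow> E \<subseteq> E' \<Longrightarrow> linked E' U"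
  unfolding linked_def using rtrancl_Restr_mono[of _ _ E U E' U] by blast

lemma not_linked_split:
  assumes "sym E" "\<not> linked E U"
  obtains A B where "U = A \<union> B" "apart E A B" "A \<noteq> {}" "B \<noteq> {}"
proof -
  obtain a b where ab: "a \<in> U" "b \<in> U" "(a, b) \<notin> (Restr E U)\<^sup>*"
    using assms by (auto simp: linked_def)
  define A where "A = {c\<in>U. (a, c) \<in> (Restr E U)\<^sup>*}"
  have "apart E A (U - A)"
  proof -
    have False if "p \<in> A" "q \<in> U - A" "(p, q) \<in> E" for p q
    proof -
      have "(p, q) \<in> Restr E U" using that by (auto simp: A_def)
      then have "(a, q) \<in> (Restr E U)\<^sup>*" using that
        unfolding A_def by (metis (mono_tags, lifting) mem_Collect_eq rtrancl.rtrancl_into_rtrancl)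
      then show False using that by (auto simp: A_def)
    qed
    then show ?thesis using assms(1) unfolding apart_def by (auto dest: symD)
  qed
  moreover have "U = A \<union> (U - A)" "A \<noteq> {}" "U - A \<noteq> {}" using ab by (auto simp: A_def)
  ultimately show ?thesis using that by blast
qed

lemma apart_linked_subset:
  assumes "apart E A B" "linked E S" "S \<subseteq> A \<union> B" "a \<in> S" "a \<in> A"
  shows "S \<subseteq> A"
proof
  fix s assume "s \<in> S"
  then have "(a, s) \<in> (Restr E S)\<^sup>*" using assms by (auto simp: linked_def)
  then show "s \<in> A" using apart_walk[OF _ assms(1,3,5)] by blast
qed

lemma facial_preorder_subset: "facial_preorder E w U \<subseteq> U \<times> U"
  by (auto simp: facial_preorder_def)

lemma facial_preorder_refl: "i \<in> U \<Longrightarrow> (i, i) \<in> facial_preorder E w U"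
  by (auto simp: facial_preorder_def)

lemma facial_preorder_le: "(i, j) \<in> facial_preorder E w U \<Longrightarrow> w i \<le> w j"
  unfolding facial_preorder_def by (auto elim: converse_rtranclE)

lemma facial_preorder_trans:
  assumes "(i, j) \<in> facial_preorder E w U" "(j, k) \<in> facial_preorder E w U"
  shows "(i, k) \<in> facial_preorder E w U"
proof -
  have "w j \<le> w k" using assms facial_preorder_le by metis
  then have "(i, j) \<in> (Restr E {l\<in>U. w l \<le> w k})\<^sup>*"
    using assms(1) unfolding facial_preorder_def by (auto elim!: rtrancl_Restr_mono)
  then show ?thesis using assms unfolding facial_preorder_def by auto
qed

lemma facial_preorder_equiv:
  "equiv U (facial_preorder E w U \<inter> (facial_preorder E w U)\<inverse>)"
proof (rule equivI)
  show "facial_preorder E w U \<inter> (facial_preorder E w U)\<inverse> \<subseteq> U \<times> U"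
    using facial_preorder_subset by fast
  show "refl_on U (facial_preorder E w U \<inter> (facial_preorder E w U)\<inverse>)"
    by (auto simp: refl_on_def facial_preorder_refl)
  show "sym (facial_preorder E w U \<inter> (facial_preorder E w U)\<inverse>)"
    by (auto simp: sym_def)
  show "trans (facial_preorder E w U \<inter> (facial_preorder E w U)\<inverse>)"
    by (rule transI) (auto intro: facial_preorder_trans)
qed

lemma facial_preorder_cong:
  assumes "Restr E U = Restr E' U" "\<And>i. i \<in> U \<Longrightarrow> w i = w' i"
  shows "facial_preorder E w U = facial_preorder E' w' U"
proof -
  have "Restr E {k\<in>U. w k \<le> w j} = Restr E' {k\<in>U. w' k \<le> w' j}" if "j \<in> U" for j
    using assms that by auto
  then show ?thesis unfolding facial_preorder_def by (auto simp del: Restr_subset)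
qed

lemma facial_preorders_cong:
  assumes "Restr E U = Restr E' U"
  shows "facial_preorders E U = facial_preorders E' U"
  unfolding facial_preorders_def using facial_preorder_cong[OF assms] by auto

lemma face_sum_cong:
  "Restr E U = Restr E' U \<Longrightarrow> face_sum x y E U = face_sum x y E' U"
  unfolding face_sum_def by (simp cong: facial_preorders_cong)

lemma facial_preorder_apart:
  assumes "apart E A B"
  shows "facial_preorder E w (A \<union> B) = facial_preorder E w A \<union> facial_preorder E w B"
proof -
  have half: "(i, j) \<in> facial_preorder E w (A \<union> B) \<longleftrightarrow> (i, j) \<in> facial_preorder E w A"
    if A: "i \<in> A" and ap: "apart E A B" for i j A B
  proof
    assume "(i, j) \<in> facial_preorder E w (A \<union> B)"
    then have "(i, j) \<in> (Restr E {k\<in>A \<union> B. w k \<le> w j})\<^sup>*" by (simp add: facial_preorder_def)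
    from apart_walk[OF this ap _ A]
    have "j \<in> A" "(i, j) \<in> (Restr E ({k\<in>A \<union> B. w k \<le> w j} \<inter> A))\<^sup>*" by auto
    moreover have "{k\<in>A \<union> B. w k \<le> w j} \<inter> A = {k\<in>A. w k \<le> w j}" by auto
    ultimately show "(i, j) \<in> facial_preorder E w A" using A by (simp add: facial_preorder_def)
  next
    assume "(i, j) \<in> facial_preorder E w A"
    then show "(i, j) \<in> facial_preorder E w (A \<union> B)"
      unfolding facial_preorder_def by (auto elim!: rtrancl_Restr_mono)
  qed
  have "(i, j) \<in> facial_preorder E w (A \<union> B) \<longleftrightarrow>
      (i, j) \<in> facial_preorder E w A \<union> facial_preorder E w B" for i j
  proof (cases "i \<in> A")
    case True
    then have "(i, j) \<notin> facial_preorder E w B" 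
      using assms facial_preorder_subset[of E w B] by (auto simp: apart_def)
    then show ?thesis using half[OF True assms] by auto
  next
    case nA: False
    then have "(i, j) \<notin> facial_preorder E w A" 
      using assms facial_preorder_subset[of E w A] by (auto simp: apart_def)
    moreover have "(i, j) \<in> facial_preorder E w (A \<union> B) \<longleftrightarrow> (i, j) \<in> facial_preorder E w B"
    proof (cases "i \<in> B")
      case True
      then show ?thesis using half[of i B A] assms by (simp add: apart_commute Un_commute)
    next
      case False
      then show ?thesis using nA facial_preorder_subset by blast
    qed
    ultimately show ?thesis by auto
  qed
  then show ?thesis by auto
qed

text \<open>
  Every vertex of a connected set lies below the heaviest ones, because no path to them is
  forbidden; and a path that is admissible for a lighter vertex avoids all the heaviest ones.
\<close>

lemma facial_preorder_top:
  assumes "linked E U"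
  shows "facial_preorder E w U =
    U \<times> {j\<in>U. \<forall>k\<in>U. w k \<le> w j} \<union> facial_preorder E w (U - {j\<in>U. \<forall>k\<in>U. w k \<le> w j})"
    (is "_ = U \<times> ?R \<union> _")
proof -
  have "(i, j) \<in> facial_preorder E w U \<longleftrightarrow> (i, j) \<in> U \<times> ?R \<union> facial_preorder E w (U - ?R)" for i j
  proof (cases "j \<in> ?R")
    case True
    then have "{k\<in>U. w k \<le> w j} = U" by auto
    then show ?thesis using True assms facial_preorder_subset[of E w "U - ?R"]
      by (auto simp: facial_preorder_def linked_def)
  next
    case False
    show ?thesis
    proof (cases "j \<in> U")
      case True
      then obtain m where m: "m \<in> U" "w j < w m" using False by force
      have "{k\<in>U. w k \<le> w j} = {k\<in>U - ?R. w k \<le> w j}" using m by force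
      moreover have "(i, j) \<in> (Restr E {k\<in>U. w k \<le> w j})\<^sup>* \<Longrightarrow> i \<in> U \<Longrightarrow> i \<notin> ?R"
      proof -
        assume "(i, j) \<in> (Restr E {k\<in>U. w k \<le> w j})\<^sup>*" "i \<in> U"
        then have "w i \<le> w j" by (auto elim: converse_rtranclE)
        then show ?thesis using m by force
      qed
      ultimately show ?thesis using False True by (auto simp: facial_preorder_def)
    next
      case False
      then show ?thesis using facial_preorder_subset[of E w U] facial_preorder_subset[of E w "U - ?R"]
        by blast
    qed
  qed
  then show ?thesis by auto
qed

lemma facial_preorders_subset: "facial_preorders E U \<subseteq> Pow (U \<times> U)"
  unfolding facial_preorders_def using facial_preorder_subset by fast

lemma finite_facial_preorders: "finite U \<Longrightarrow> finite (facial_preorders E U)"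
  by (rule finite_subset[OF facial_preorders_subset]) simp

lemma facial_preorders_refl: "c \<in> facial_preorders E U \<Longrightarrow> i \<in> U \<Longrightarrow> (i, i) \<in> c"
  by (auto simp: facial_preorders_def facial_preorder_refl)

lemma finite_blocks: "finite U \<Longrightarrow> finite (blocks c U)"
  unfolding blocks_def quotient_def by auto

lemma card_blocks_le: "finite U \<Longrightarrow> card (blocks c U) \<le> card U"
  unfolding blocks_def quotient_def UNION_singleton_eq_range by (rule card_image_le)

lemma card_quotient_Un:
  assumes fin: "finite A" "finite B" and disj: "A \<inter> B = {}"
    and "r \<subseteq> A \<times> A" "s \<subseteq> B \<times> B" and refl: "\<And>a. a \<in> A \<Longrightarrow> (a, a) \<in> r"
  shows "card ((A \<union> B) // (r \<union> s)) = card (A // r) + card (B // s)"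
proof -
  have A: "(r \<union> s) `` {a} = r `` {a}" if "a \<in> A" for a using that assms by auto
  have B: "(r \<union> s) `` {b} = s `` {b}" if "b \<in> B" for b using that assms by auto
  have "(A \<union> B) // (r \<union> s) = A // r \<union> B // s"
    unfolding quotient_def using A B by auto
  moreover have "A // r \<inter> B // s = {}"
    unfolding quotient_def using assms by blast
  ultimately show ?thesis using fin by (simp add: card_Un_disjoint finite_quotient quotient_def)
qed

lemma card_blocks_Un:
  assumes "finite A" "finite B" "A \<inter> B = {}"
    "c \<subseteq> A \<times> A" "d \<subseteq> B \<times> B" "\<And>a. a \<in> A \<Longrightarrow> (a, a) \<in> c"
  shows "card (blocks (c \<union> d) (A \<union> B)) = card (blocks c A) + card (blocks d B)"
proof -
  have "(c \<union> d) \<inter> (c \<union> d)\<inverse> = (c \<inter> c\<inverse>) \<union> (d \<inter> d\<inverse>)" using assms by auto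
  then show ?thesis unfolding blocks_def using assms by (simp only:) (rule card_quotient_Un, auto)
qed

lemma card_blocks_top:
  assumes "finite U" "R \<subseteq> U" "R \<noteq> {}" "d \<subseteq> (U - R) \<times> (U - R)"
  shows "card (blocks (U \<times> R \<union> d) U) = Suc (card (blocks d (U - R)))"
proof -
  have eq: "(U \<times> R \<union> d) \<inter> (U \<times> R \<union> d)\<inverse> = (R \<times> R) \<union> (d \<inter> d\<inverse>)" using assms by auto
  have U: "U = R \<union> (U - R)" using assms by auto
  have "card ((R \<union> (U - R)) // ((R \<times> R) \<union> (d \<inter> d\<inverse>))) =
      card (R // (R \<times> R)) + card ((U - R) // (d \<inter> d\<inverse>))"
    using assms finite_subset[of R U] by (intro card_quotient_Un) auto
  moreover have "R // (R \<times> R) = {R}" using assms by (auto simp: quotient_def)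
  ultimately show ?thesis unfolding blocks_def eq using U by simp
qed

lemma face_sum_empty [simp]: "face_sum x y E {} = 1"
proof -
  have "facial_preorders E {} = {{}}"
    by (auto simp: facial_preorders_def facial_preorder_def)
  then show ?thesis by (simp add: face_sum_def blocks_def)
qed

text \<open>
  Weights on two sets without edges between them can be chosen independently, and no path
  leaves its side, so a facial preorder of the union is a pair of facial preorders.
\<close>

lemma face_sum_apart:
  assumes ap: "apart E A B" and fin: "finite A" "finite B"
  shows "face_sum x y E (A \<union> B) = face_sum x y E A * face_sum x y E B"
proof -
  let ?g = "\<lambda>U c. x ^ card (blocks c U) * y ^ (card U - card (blocks c U))"
  have disj: "A \<inter> B = {}" using ap by (auto simp: apart_def)
  have sub: "c \<subseteq> A \<times> A" "d \<subseteq> B \<times> B" if "c \<in> facial_preorders E A" "d \<in> facial_preorders E B" for c d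
    using that facial_preorders_subset by fast+
  have bij: "bij_betw (\<lambda>(c, d). c \<union> d) (facial_preorders E A \<times> facial_preorders E B)
      (facial_preorders E (A \<union> B))"
  proof (rule bij_betw_imageI)
    show "inj_on (\<lambda>(c, d). c \<union> d) (facial_preorders E A \<times> facial_preorders E B)"
    proof (rule inj_onI, clarify)
      fix c d c' d'
      assume h: "c \<in> facial_preorders E A" "d \<in> facial_preorders E B"
        "c' \<in> facial_preorders E A" "d' \<in> facial_preorders E B" "c \<union> d = c' \<union> d'"
      have "c = (c \<union> d) \<inter> A \<times> A" "c' = (c' \<union> d') \<inter> A \<times> A"
        "d = (c \<union> d) \<inter> B \<times> B" "d' = (c' \<union> d') \<inter> B \<times> B"
        using sub[OF h(1,2)] sub[OF h(3,4)] disj by auto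
      then show "c = c' \<and> d = d'" using h(5) by metis
    qed
    show "(\<lambda>(c, d). c \<union> d) ` (facial_preorders E A \<times> facial_preorders E B) =
        facial_preorders E (A \<union> B)"
    proof (intro equalityI subsetI)
      fix c assume "c \<in> (\<lambda>(c, d). c \<union> d) ` (facial_preorders E A \<times> facial_preorders E B)"
      then obtain v w where c: "c = facial_preorder E v A \<union> facial_preorder E w B"
        by (auto simp: facial_preorders_def)
      let ?u = "\<lambda>i. if i \<in> A then v i else w i"
      have "facial_preorder E v A = facial_preorder E ?u A"
        "facial_preorder E w B = facial_preorder E ?u B"
        using disj by (auto intro!: facial_preorder_cong)
      then have "c = facial_preorder E ?u (A \<union> B)"
        using c facial_preorder_apart[OF ap] by simp
      then show "c \<in> facial_preorders E (A \<union> B)" by (auto simp: facial_preorders_def)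
    next
      fix c assume "c \<in> facial_preorders E (A \<union> B)"
      then show "c \<in> (\<lambda>(c, d). c \<union> d) ` (facial_preorders E A \<times> facial_preorders E B)"
        by (auto simp: facial_preorders_def facial_preorder_apart[OF ap])
    qed
  qed
  have "face_sum x y E (A \<union> B) =
      (\<Sum>(c, d)\<in>facial_preorders E A \<times> facial_preorders E B. ?g (A \<union> B) (c \<union> d))"
    unfolding face_sum_def
    by (subst sum.reindex_bij_betw[OF bij, symmetric]) (auto intro: sum.cong)
  also have "\<dots> = (\<Sum>(c, d)\<in>facial_preorders E A \<times> facial_preorders E B. ?g A c * ?g B d)"
  proof (rule sum.cong[OF refl], clarify)
    fix c d assume h: "c \<in> facial_preorders E A" "d \<in> facial_preorders E B"
    have "card (blocks (c \<union> d) (A \<union> B)) = card (blocks c A) + card (blocks d B)"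
      using fin disj sub[OF h] facial_preorders_refl[OF h(1)] by (intro card_blocks_Un) auto
    moreover have "card (A \<union> B) = card A + card B" using fin disj by (simp add: card_Un_disjoint)
    moreover have "card (blocks c A) \<le> card A" "card (blocks d B) \<le> card B"
      using fin by (auto intro: card_blocks_le)
    ultimately have "card (blocks (c \<union> d) (A \<union> B)) = card (blocks c A) + card (blocks d B)"
      "card (A \<union> B) - (card (blocks c A) + card (blocks d B)) =
        (card A - card (blocks c A)) + (card B - card (blocks d B))"
      by linarith+
    then show "?g (A \<union> B) (c \<union> d) = ?g A c * ?g B d"
      by (simp only: power_add) (simp only: mult_ac)
  qed
  also have "\<dots> = face_sum x y E A * face_sum x y E B"
    unfolding face_sum_def sum_product sum.cartesian_product by simp
  finally show ?thesis .
qed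

text \<open>
  The summand \<open>W\<close> collects the preorders whose top block is \<open>U - W\<close>; raising the weights on
  \<open>U - W\<close> above all others realises any preorder on \<open>W\<close> below it. The term for \<open>W = U\<close> belongs to
  no preorder. Adding it to both sides makes the right-hand side a convolution over all subsets,
  a shape that passes through products and sums over sets.
\<close>

lemma face_sum_linked:
  assumes conn: "linked E U" and fin: "finite U" and ne: "U \<noteq> {}"
  shows "(x + y) * face_sum x y E U = x * (\<Sum>W\<in>Pow U. y ^ card (U - W) * face_sum x y E W)"
proof -
  let ?g = "\<lambda>U c. x ^ card (blocks c U) * y ^ (card U - card (blocks c U))"
  let ?D = "SIGMA W:Pow U - {U}. facial_preorders E W"
  let ?f = "\<lambda>(W, d). U \<times> (U - W) \<union> d"
  have dsub: "d \<subseteq> W \<times> W" if "d \<in> facial_preorders E W" for d W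
    using that facial_preorders_subset by fast
  have bij: "bij_betw ?f ?D (facial_preorders E U)"
  proof (rule bij_betw_imageI)
    show "inj_on ?f ?D"
    proof (rule inj_onI)
      fix p p' assume "p \<in> ?D" "p' \<in> ?D" and eq': "?f p = ?f p'"
      then obtain W d W' d' where p: "p = (W, d)" "p' = (W', d')"
        and W: "W \<subseteq> U" "W \<noteq> U" and W': "W' \<subseteq> U" "W' \<noteq> U"
        and d: "d \<in> facial_preorders E W" and d': "d' \<in> facial_preorders E W'"
        by blast
      have eq: "U \<times> (U - W) \<union> d = U \<times> (U - W') \<union> d'" using eq' p by simp
      \<comment> \<open>The complement of \<open>W\<close> is recovered as the set of greatest elements.\<close>
      have top: "U - W = {j\<in>U. \<forall>i\<in>U. (i, j) \<in> U \<times> (U - W) \<union> d}"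
        if "W \<subseteq> U" "W \<noteq> U" "d \<in> facial_preorders E W" for W d
        using that dsub[OF that(3)] by auto
      have "U - W = U - W'" using top[OF W d] top[OF W' d'] eq by metis
      then have WW: "W = W'" using W W' by auto
      have "d = (U \<times> (U - W) \<union> d) \<inter> W \<times> W" "d' = (U \<times> (U - W') \<union> d') \<inter> W' \<times> W'"
        using dsub[OF d] dsub[OF d'] by auto
      then show "p = p'" using eq WW p by metis
    qed
    show "?f ` ?D = facial_preorders E U"
    proof (intro equalityI subsetI)
      fix c assume "c \<in> ?f ` ?D"
      then obtain W w where W: "W \<subseteq> U" "W \<noteq> U"
        and c: "c = U \<times> (U - W) \<union> facial_preorder E w W"
        by (auto simp: facial_preorders_def)
      \<comment> \<open>The vertices outside \<open>W\<close> get one common weight above all weights inside \<open>W\<close>.\<close>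
      define v where "v = (\<lambda>i. if i \<in> W then w i else (\<Sum>k\<in>W. \<bar>w k\<bar>) + 1)"
      have finW: "finite W" using W fin finite_subset by blast
      have big: "w i < (\<Sum>k\<in>W. \<bar>w k\<bar>) + 1" if "i \<in> W" for i
        using member_le_sum[of i W "\<lambda>k. \<bar>w k\<bar>"] finW that by force
      have top: "{j\<in>U. \<forall>k\<in>U. v k \<le> v j} = U - W"
      proof (intro equalityI subsetI)
        fix j assume j: "j \<in> {j\<in>U. \<forall>k\<in>U. v k \<le> v j}"
        obtain k where "k \<in> U" "k \<notin> W" using W by auto
        then have "(\<Sum>k\<in>W. \<bar>w k\<bar>) + 1 \<le> v j" using j by (auto simp: v_def)
        then show "j \<in> U - W" using j big by (force simp: v_def)
      next
        fix j assume "j \<in> U - W"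
        then show "j \<in> {j\<in>U. \<forall>k\<in>U. v k \<le> v j}" using big by (force simp: v_def)
      qed
      have "U - (U - W) = W" using W by auto
      then have "facial_preorder E v U = U \<times> (U - W) \<union> facial_preorder E v W"
        using facial_preorder_top[OF conn, of v] unfolding top by simp
      also have "facial_preorder E v W = facial_preorder E w W"
        by (rule facial_preorder_cong) (auto simp: v_def)
      finally show "c \<in> facial_preorders E U" using c by (auto simp: facial_preorders_def)
    next
      fix c assume "c \<in> facial_preorders E U"
      then obtain w where c: "c = facial_preorder E w U" by (auto simp: facial_preorders_def)
      let ?R = "{j\<in>U. \<forall>k\<in>U. w k \<le> w j}"
      have "Max (w ` U) \<in> w ` U" using fin ne by (intro Lattices_Big.Max_in) auto
      then obtain m where "m \<in> U" "w m = Max (w ` U)" by force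
      then have "m \<in> ?R" using fin by auto
      then have "U - ?R \<in> Pow U - {U}" by blast
      moreover have "U - (U - ?R) = ?R" by auto
      ultimately have "c = ?f (U - ?R, facial_preorder E w (U - ?R))"
        "(U - ?R, facial_preorder E w (U - ?R)) \<in> ?D"
        using c facial_preorder_top[OF conn, of w] by (auto simp: facial_preorders_def)
      then show "c \<in> ?f ` ?D" by blast
    qed
  qed
  have "y * face_sum x y E U = (\<Sum>(W, d)\<in>?D. y * ?g U (U \<times> (U - W) \<union> d))"
    unfolding face_sum_def sum_distrib_left
    by (subst sum.reindex_bij_betw[OF bij, symmetric]) (auto intro: sum.cong)
  also have "\<dots> = (\<Sum>(W, d)\<in>?D. x * (y ^ card (U - W) * ?g W d))"
  proof (rule sum.cong[OF refl])
    fix p assume "p \<in> ?D"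
    then obtain W d where p: "p = (W, d)" and W: "W \<subseteq> U" "W \<noteq> U"
      and d: "d \<in> facial_preorders E W" by blast
    have finW: "finite W" using W fin finite_subset by blast
    have "U - (U - W) = W" using W by auto
    then have "card (blocks (U \<times> (U - W) \<union> d) U) = Suc (card (blocks d W))"
      using card_blocks_top[of U "U - W" d] fin W dsub[OF d] by auto
    moreover have "card U = card (U - W) + card W"
      using fin W finW by (metis card_Diff_subset card_mono le_add_diff_inverse2)
    moreover have "card (U - W) > 0" using W fin by (auto simp: card_gt_0_iff)
    moreover have "card (blocks d W) \<le> card W" using finW by (rule card_blocks_le)
    moreover from calculation have "Suc (card U - Suc (card (blocks d W))) = card (U - W) + (card W - card (blocks d W))"
      by auto
    then have "y * y ^ (card U - Suc (card (blocks d W))) = y ^ card (U - W) * y ^ (card W - card (blocks d W))"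
      by (metis power_Suc power_add)
    ultimately show "(case p of (W, d) \<Rightarrow> y * ?g U (U \<times> (U - W) \<union> d)) =
        (case p of (W, d) \<Rightarrow> x * (y ^ card (U - W) * ?g W d))"
      by (simp add: p algebra_simps)
  qed
  also have "\<dots> = (\<Sum>W\<in>Pow U - {U}. x * (y ^ card (U - W) * face_sum x y E W))"
    unfolding face_sum_def sum_distrib_left
    by (rule sum.Sigma[symmetric])
       (use fin in \<open>auto intro!: finite_facial_preorders intro: finite_subset\<close>)
  also have "\<dots> = x * (\<Sum>W\<in>Pow U - {U}. y ^ card (U - W) * face_sum x y E W)"
    by (simp add: sum_distrib_left)
  finally have "y * face_sum x y E U = \<dots>" .
  moreover have "(\<Sum>W\<in>Pow U. y ^ card (U - W) * face_sum x y E W) =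
      face_sum x y E U + (\<Sum>W\<in>Pow U - {U}. y ^ card (U - W) * face_sum x y E W)"
    using fin by (subst sum.remove[of _ U]) auto
  ultimately show ?thesis by (simp add: algebra_simps)
qed

section \<open>Adding an edge\<close>

text \<open>
  To be used on the complement of \<open>S\<close>: making all neighbours of \<open>S\<close> adjacent keeps a connected
  graph connected when \<open>S\<close> is removed. In an undirected graph every neighbour also gets a loop,
  which is harmless for connectivity.
\<close>

definition reconnect :: "('v \<times> 'v) set \<Rightarrow> 'v set \<Rightarrow> ('v \<times> 'v) set" where
  "reconnect E S = {(a, b). (a, b) \<in> E \<or> (\<exists>s\<in>S. \<exists>s'\<in>S. (a, s) \<in> E \<and> (s', b) \<in> E)}"

abbreviation add_edge :: "('v \<times> 'v) set \<Rightarrow> 'v \<Rightarrow> 'v \<Rightarrow> ('v \<times> 'v) set" where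
  "add_edge E u v \<equiv> insert (u, v) (insert (v, u) E)"

text \<open>
  Exactly these sets enter the building set when the edge \<open>uv\<close> is added.
\<close>

definition joined :: "('v \<times> 'v) set \<Rightarrow> 'v \<Rightarrow> 'v \<Rightarrow> 'v set \<Rightarrow> 'v set set" where
  "joined E u v U =
     {S\<in>Pow U. u \<in> S \<and> v \<in> S \<and> linked (add_edge E u v) S \<and> \<not> linked E S}"

lemma sym_reconnect: "sym E \<Longrightarrow> sym (reconnect E S)"
  unfolding reconnect_def sym_def by blast

lemma sym_add_edge: "sym E \<Longrightarrow> sym (add_edge E u v)"
  by (auto simp: sym_def)

lemma linked_reconnect:
  assumes "linked E U"
  shows "linked (reconnect E S) (U - S)"
proof -
  let ?R = "(Restr (reconnect E S) (U - S))\<^sup>*"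
  have "(b \<notin> S \<longrightarrow> (a, b) \<in> ?R) \<and> (b \<in> S \<longrightarrow> (\<exists>c s. c \<in> U - S \<and> s \<in> S \<and> (c, s) \<in> E \<and> (a, c) \<in> ?R))"
    if "a \<in> U - S" and "(a, b) \<in> (Restr E U)\<^sup>*" for a b
    using that(2)
  proof (induction rule: rtrancl_induct)
    case base
    then show ?case using that by auto
  next
    case (step b d)
    show ?case
    proof (cases "b \<in> S")
      case True
      then obtain c s where c: "c \<in> U - S" "s \<in> S" "(c, s) \<in> E" "(a, c) \<in> ?R"
        using step.IH by blast
      have "(c, d) \<in> Restr (reconnect E S) (U - S)" if "d \<notin> S"
        using c that step.hyps True unfolding reconnect_def by blast
      then show ?thesis using c by (meson rtrancl.rtrancl_into_rtrancl)
    next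
      case False
      then have b: "b \<in> U - S" "(a, b) \<in> ?R" using step by auto
      have "(b, d) \<in> Restr (reconnect E S) (U - S)" if "d \<notin> S"
        using b that step.hyps unfolding reconnect_def by blast
      then show ?thesis using b step.hyps by (auto intro: rtrancl.rtrancl_into_rtrancl)
    qed
  qed
  then show ?thesis using assms unfolding linked_def by blast
qed

lemma apart_reconnect:
  "apart E A B \<Longrightarrow> S \<subseteq> A \<Longrightarrow> apart (reconnect E S) (A - S) B"
  unfolding apart_def reconnect_def by blast

lemma Restr_reconnect:
  "apart E A B \<Longrightarrow> S \<subseteq> A \<Longrightarrow> Restr (reconnect E S) B = Restr E B"
  unfolding apart_def reconnect_def by blast

lemma joined_mono: "W \<subseteq> U \<Longrightarrow> joined E u v W = {S \<in> joined E u v U. S \<subseteq> W}"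
  unfolding joined_def by auto

lemma finite_joined: "finite U \<Longrightarrow> finite (joined E u v U)"
  unfolding joined_def by auto

lemma joined_split:
  assumes sym: "sym E" and S: "S \<in> joined E u v U"
  obtains A B where "S = A \<union> B" "apart E A B" "A \<noteq> {}" "B \<noteq> {}" "linked E A" "linked E B"
proof -
  let ?E = "add_edge E u v"
  have S': "u \<in> S" "v \<in> S" "linked ?E S" "\<not> linked E S" using S by (auto simp: joined_def)
  \<comment> \<open>If one side of a separation of \<open>E\<close> avoided both \<open>u\<close> and \<open>v\<close>, it would stay
    separated after adding the edge.\<close>
  have mixed: "u \<in> B \<or> v \<in> B" if "S = A \<union> B" "apart E A B" "A \<noteq> {}" "B \<noteq> {}" for A B
  proof (rule ccontr)
    assume "\<not> (u \<in> B \<or> v \<in> B)"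
    then have "apart ?E A B" using that(2) by (auto simp: apart_def)
    then show False using apart_linked_subset[of ?E A B S] S'(3) that by (auto simp: apart_def)
  qed
  obtain A B where AB: "S = A \<union> B" "apart E A B" "A \<noteq> {}" "B \<noteq> {}"
    using not_linked_split[OF sym S'(4)] .
  have link: "linked E A" if AB: "S = A \<union> B" "apart E A B" "A \<noteq> {}" "B \<noteq> {}" for A B
  proof (rule ccontr)
    assume "\<not> linked E A"
    then obtain A1 A2 where A: "A = A1 \<union> A2" "apart E A1 A2" "A1 \<noteq> {}" "A2 \<noteq> {}"
      using not_linked_split[OF sym] by blast
    have "apart E (A2 \<union> B) A1" "apart E (A1 \<union> B) A2" "apart E A B"
      using A AB unfolding apart_def by blast+
    moreover have "S = (A2 \<union> B) \<union> A1" "S = (A1 \<union> B) \<union> A2" using A AB by auto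
    ultimately have "u \<in> A1 \<or> v \<in> A1" "u \<in> A2 \<or> v \<in> A2" "u \<in> B \<or> v \<in> B"
      using mixed A AB by (metis Un_empty)+
    then show False using A(2) AB(2) unfolding A(1) apart_def by blast
  qed
  have "S = B \<union> A" "apart E B A" using AB apart_commute by auto
  then have "linked E A" "linked E B" using link AB by blast+
  then show ?thesis using that AB by blast
qed

text \<open>
  The convolution of \<open>face_sum_linked\<close> over a disjoint union is the product of the convolutions
  over the two parts.
\<close>

lemma face_sum_two_linked:
  assumes ap: "apart E A B" and l: "linked E A" "linked E B" and fin: "finite A" "finite B"
    and ne: "A \<noteq> {}" "B \<noteq> {}"
  shows "(x + y)\<^sup>2 * face_sum x y E (A \<union> B) =
    x\<^sup>2 * (\<Sum>W\<in>Pow (A \<union> B). y ^ card (A \<union> B - W) * face_sum x y E W)"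
proof -
  let ?g = "\<lambda>U W. y ^ card (U - W) * face_sum x y E W"
  have disj: "A \<inter> B = {}" using ap by (auto simp: apart_def)
  have bij: "bij_betw (\<lambda>(V, W). V \<union> W) (Pow A \<times> Pow B) (Pow (A \<union> B))"
    by (rule bij_betw_byWitness[where f' = "\<lambda>W. (W \<inter> A, W \<inter> B)"]) (use disj in auto)
  have "(\<Sum>W\<in>Pow (A \<union> B). ?g (A \<union> B) W) = (\<Sum>(V, W)\<in>Pow A \<times> Pow B. ?g (A \<union> B) (V \<union> W))"
    by (subst sum.reindex_bij_betw[OF bij, symmetric]) (auto intro: sum.cong)
  also have "\<dots> = (\<Sum>(V, W)\<in>Pow A \<times> Pow B. ?g A V * ?g B W)"
  proof (rule sum.cong[OF refl])
    fix p assume "p \<in> Pow A \<times> Pow B"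
    then obtain V W where p: "p = (V, W)" "V \<subseteq> A" "W \<subseteq> B" by auto
    have "A \<union> B - (V \<union> W) = (A - V) \<union> (B - W)" using p disj by auto
    then have "card (A \<union> B - (V \<union> W)) = card (A - V) + card (B - W)"
      using card_Un_disjoint[of "A - V" "B - W"] fin disj by auto
    moreover have "apart E V W" using p ap unfolding apart_def by blast
    then have "face_sum x y E (V \<union> W) = face_sum x y E V * face_sum x y E W"
      using p fin by (intro face_sum_apart) (auto intro: finite_subset)
    ultimately show "(case p of (V, W) \<Rightarrow> ?g (A \<union> B) (V \<union> W)) =
        (case p of (V, W) \<Rightarrow> ?g A V * ?g B W)"
      by (simp add: p(1) power_add)
  qed
  also have "\<dots> = (\<Sum>V\<in>Pow A. ?g A V) * (\<Sum>W\<in>Pow B. ?g B W)"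
    by (simp add: sum_product sum.cartesian_product)
  finally have "x\<^sup>2 * (\<Sum>W\<in>Pow (A \<union> B). ?g (A \<union> B) W) =
      (x * (\<Sum>V\<in>Pow A. ?g A V)) * (x * (\<Sum>W\<in>Pow B. ?g B W))"
    by (simp add: power2_eq_square)
  also have "\<dots> = ((x + y) * face_sum x y E A) * ((x + y) * face_sum x y E B)"
    unfolding face_sum_linked[OF l(1) fin(1) ne(1)] face_sum_linked[OF l(2) fin(2) ne(2)] ..
  also have "\<dots> = (x + y)\<^sup>2 * face_sum x y E (A \<union> B)"
    using face_sum_apart[OF ap fin, of x y] by (simp add: power2_eq_square)
  finally show ?thesis by simp
qed

lemma sum_supersets:
  assumes "finite U" "S \<subseteq> U"
  shows "(\<Sum>W\<in>{W\<in>Pow U. S \<subseteq> W}. f W) = (\<Sum>X\<in>Pow (U - S). f (S \<union> X))"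
proof -
  have "bij_betw (\<lambda>X. S \<union> X) (Pow (U - S)) {W\<in>Pow U. S \<subseteq> W}"
    by (rule bij_betw_byWitness[where f' = "\<lambda>W. W - S"]) (use assms in auto)
  then show ?thesis by (rule sum.reindex_bij_betw[symmetric])
qed

text \<open>
  By induction on \<open>U\<close>. Both sides split off components of the enlarged graph, so \<open>U\<close> may be taken
  connected, where the left-hand side satisfies the recursion \<open>face_sum_linked\<close>. To see that
  the right-hand side satisfies it as well, exchange the sums over \<open>W\<close> and \<open>S\<close>: for fixed \<open>S\<close>,
  the sum over the sets \<open>W\<close> between \<open>S\<close> and \<open>U\<close> is the recursion in the reconnected graph on
  \<open>U - S\<close>. If \<open>U\<close> was not connected before, then \<open>S = U\<close> is one of the sets; its term compensates
  for \<open>E\<close> having two components on \<open>U\<close> and hence satisfying a quadratic form of the recursion.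
\<close>

lemma face_sum_add_edge:
  fixes x y :: "'r::idom"
  assumes sym: "sym E" and fin: "finite U" and y: "y \<noteq> 0"
  shows "x * face_sum x y (add_edge E u v) U = x * face_sum x y E U +
    (x + y) * (\<Sum>S\<in>joined E u v U.
      face_sum x y E S * face_sum x y (reconnect (add_edge E u v) S) (U - S))"
  using fin
proof (induction U rule: finite_psubset_induct)
  case (psubset U)
  let ?E = "add_edge E u v"
  let ?P = "face_sum x y E" and ?P' = "face_sum x y ?E"
  let ?Q = "\<lambda>S. face_sum x y (reconnect ?E S)"
  let ?J = "joined E u v"
  define D where "D = (\<lambda>W. \<Sum>S\<in>?J W. ?P S * ?Q S (W - S))"
  have IH: "x * ?P' W = x * ?P W + (x + y) * D W" if "W \<subset> U" for W
    using psubset.IH[OF that] by (simp add: D_def)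
  have fin: "finite U" by fact
  consider (outside) "u \<notin> U \<or> v \<notin> U" | (unlinked) "u \<in> U" "v \<in> U" "\<not> linked ?E U"
    | (linked) "u \<in> U" "v \<in> U" "linked ?E U"
    by blast
  then have "x * ?P' U = x * ?P U + (x + y) * D U"
  proof cases
    case outside
    then have "Restr ?E U = Restr E U" "?J U = {}" by (auto simp: joined_def)
    then show ?thesis using face_sum_cong[of ?E U E x y] by (simp add: D_def)
  next
    case unlinked
    have "\<exists>A B. U = A \<union> B \<and> apart ?E A B \<and> B \<noteq> {} \<and> u \<in> A"
    proof -
      obtain A B where "U = A \<union> B" "apart ?E A B" "A \<noteq> {}" "B \<noteq> {}"
        using not_linked_split[OF sym_add_edge[OF sym] unlinked(3)] by blast
      then show ?thesis using unlinked(1) apart_commute[of ?E A B]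
        by (metis UnE Un_commute)
    qed
    then obtain A B where AB: "U = A \<union> B" "apart ?E A B" "B \<noteq> {}" "u \<in> A" by blast
    then have vA: "v \<in> A" using unlinked(2) by (auto simp: apart_def)
    have apE: "apart E A B" using AB by (auto simp: apart_def)
    have finAB: "finite A" "finite B" using fin AB by auto
    have B: "?P' B = ?P B" using AB vA by (intro face_sum_cong) (auto simp: apart_def)
    have J: "?J U = ?J A"
    proof -
      have "S \<subseteq> A" if "S \<in> ?J U" for S
        using that AB vA apart_linked_subset[OF AB(2), of S u] by (auto simp: joined_def)
      then show ?thesis using AB(1) by (auto simp: joined_def)
    qed
    have "?Q S (U - S) = ?Q S (A - S) * ?P B" if "S \<in> ?J A" for S
    proof -
      have S: "S \<subseteq> A" using that by (auto simp: joined_def)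
      then have "U - S = (A - S) \<union> B" using AB by (auto simp: apart_def)
      then have "?Q S (U - S) = ?Q S (A - S) * ?Q S B"
        using face_sum_apart[OF apart_reconnect[OF AB(2) S]] finAB by simp
      also have "?Q S B = ?P' B" by (rule face_sum_cong[OF Restr_reconnect[OF AB(2) S]])
      finally show ?thesis using B by simp
    qed
    then have "D U = D A * ?P B"
      unfolding D_def J sum_distrib_right by (intro sum.cong) (auto simp: mult.assoc)
    moreover have "x * ?P' A * ?P B = (x * ?P A + (x + y) * D A) * ?P B"
      using AB by (subst IH) (auto simp: apart_def)
    moreover have "?P U = ?P A * ?P B" "?P' U = ?P' A * ?P B"
      using face_sum_apart[OF apE finAB, of x y] face_sum_apart[OF AB(2) finAB, of x y] AB(1) B
      by simp_all
    ultimately show ?thesis by (simp add: algebra_simps)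
  next
    case linked
    define L where "L = (\<Sum>W\<in>Pow U. y ^ card (U - W) * ?P W)"
    define T where "T = (\<lambda>S. (\<Sum>X\<in>Pow (U - S). y ^ card (U - S - X) * ?Q S X))"
    define M where "M = (\<Sum>W\<in>Pow U. y ^ card (U - W) * D W)"
    have ne: "U \<noteq> {}" using linked by auto
    have finJ: "finite (?J U)" using fin by (rule finite_joined)
    have split: "(\<Sum>W\<in>Pow U. f W) = f U + (\<Sum>W\<in>Pow U - {U}. f W)" for f :: "_ \<Rightarrow> 'r"
      using fin by (subst sum.remove[of _ U]) auto
    have "x * ((x + y) * ?P' U) = x * (\<Sum>W\<in>Pow U. y ^ card (U - W) * (x * ?P' W))"
      unfolding face_sum_linked[OF linked(3) fin ne] by (simp add: sum_distrib_left mult_ac)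
    also have "(\<Sum>W\<in>Pow U. y ^ card (U - W) * (x * ?P' W)) =
        x * ?P' U + (\<Sum>W\<in>Pow U - {U}. y ^ card (U - W) * (x * ?P W + (x + y) * D W))"
      unfolding split by (auto intro!: sum.cong simp: IH psubset_eq)
    also have "(\<Sum>W\<in>Pow U - {U}. y ^ card (U - W) * (x * ?P W + (x + y) * D W)) =
        x * (L - ?P U) + (x + y) * (M - D U)"
      unfolding L_def M_def split
      by (simp add: sum_distrib_left sum.distrib algebra_simps)
    finally have rec: "y * (x * ?P' U) = x * (x * (L - ?P U) + (x + y) * (M - D U))"
      by (simp add: algebra_simps)
    have "M = (\<Sum>W\<in>Pow U. \<Sum>S\<in>{S. S \<in> ?J U \<and> S \<subseteq> W}. y ^ card (U - W) * (?P S * ?Q S (W - S)))"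
      unfolding M_def D_def sum_distrib_left by (intro sum.cong refl joined_mono) auto
    also have "\<dots> = (\<Sum>S\<in>?J U. \<Sum>W\<in>{W. W \<in> Pow U \<and> S \<subseteq> W}. y ^ card (U - W) * (?P S * ?Q S (W - S)))"
      by (rule sum.swap_restrict) (use fin finJ in auto)
    also have "\<dots> = (\<Sum>S\<in>?J U. ?P S * (\<Sum>X\<in>Pow (U - S). y ^ card (U - S - X) * ?Q S X))"
    proof (rule sum.cong[OF refl])
      fix S assume "S \<in> ?J U"
      then have S: "S \<subseteq> U" by (auto simp: joined_def)
      have "U - (S \<union> X) = U - S - X" "X \<subseteq> U - S \<Longrightarrow> (S \<union> X) - S = X" for X by auto
      then show "(\<Sum>W\<in>{W. W \<in> Pow U \<and> S \<subseteq> W}. y ^ card (U - W) * (?P S * ?Q S (W - S))) =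
          ?P S * (\<Sum>X\<in>Pow (U - S). y ^ card (U - S - X) * ?Q S X)"
        unfolding sum_supersets[OF fin S] sum_distrib_left
        by (intro sum.cong) (auto simp: mult_ac)
    qed
    also have "\<dots> = (\<Sum>S\<in>?J U. ?P S * T S)" by (simp add: T_def)
    finally have M: "M = (\<Sum>S\<in>?J U. ?P S * T S)" .
    have K: "x * (?P S * T S) = (x + y) * (?P S * ?Q S (U - S))" if "S \<in> ?J U" "S \<noteq> U" for S
    proof -
      have "x * T S = (x + y) * ?Q S (U - S)"
        unfolding T_def using that fin linked_reconnect[OF linked(3), of S]
        by (intro face_sum_linked[symmetric]) (auto simp: joined_def)
      then show ?thesis
        by (simp only: mult.left_commute[of x "?P S"]) (simp only: mult.left_commute)
    qed
    have TU: "T U = 1" by (simp add: T_def)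
    have "y * (x * ?P' U) = y * (x * ?P U + (x + y) * D U)"
    proof (cases "linked E U")
      case True
      then have UJ: "U \<notin> ?J U" by (auto simp: joined_def)
      have xM: "x * M = (x + y) * D U"
        unfolding M D_def sum_distrib_left
        by (rule sum.cong[OF refl], rule K) (use UJ in auto)
      have xL: "x * L = (x + y) * ?P U"
        unfolding L_def using face_sum_linked[OF True fin ne, of x y] by simp
      have "y * (x * ?P' U) = x * (x * L) - x * x * ?P U + (x + y) * (x * M) - x * (x + y) * D U"
        unfolding rec by (simp add: algebra_simps)
      also have "\<dots> = y * (x * ?P U + (x + y) * D U)"
        unfolding xM xL by (simp add: algebra_simps)
      finally show ?thesis .
    next
      case False
      then have UJ: "U \<in> ?J U" using linked by (auto simp: joined_def)
      have DU: "D U = ?P U + (\<Sum>S\<in>?J U - {U}. ?P S * ?Q S (U - S))"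
        unfolding D_def by (subst sum.remove[OF finJ UJ]) simp
      have "x * M = x * ?P U + (\<Sum>S\<in>?J U - {U}. x * (?P S * T S))"
        unfolding M sum_distrib_left by (subst sum.remove[OF finJ UJ]) (simp add: TU)
      also have "\<dots> = x * ?P U + (\<Sum>S\<in>?J U - {U}. (x + y) * (?P S * ?Q S (U - S)))"
        by (rule arg_cong[of _ _ "(+) _"], rule sum.cong[OF refl], rule K) auto
      also have "\<dots> = x * ?P U + (x + y) * (D U - ?P U)"
        by (simp add: DU sum_distrib_left)
      finally have xM: "x * M = x * ?P U + (x + y) * (D U - ?P U)" .
      obtain A B where AB: "U = A \<union> B" "apart E A B" "A \<noteq> {}" "B \<noteq> {}" "linked E A" "linked E B"
        using joined_split[OF sym UJ] .
      have xL: "x * (x * L) = (x + y) * (x + y) * ?P U"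
        unfolding L_def using face_sum_two_linked[OF AB(2,5,6) _ _ AB(3,4), of x y] fin AB(1)
        by (simp add: power2_eq_square mult.assoc)
      have "y * (x * ?P' U) = x * (x * L) - x * x * ?P U + (x + y) * (x * M) - x * (x + y) * D U"
        unfolding rec by (simp add: algebra_simps)
      also have "\<dots> = y * (x * ?P U + (x + y) * D U)"
        unfolding xM xL by (simp add: algebra_simps)
      finally show ?thesis .
    qed
    then show ?thesis using y by simp
  qed
  then show ?case by (simp add: D_def)
qed

section \<open>Polynomials with nonnegative gamma-vector\<close>

text \<open>
  The exponent of \<open>x\<close> is the codimension of the face. With \<open>x = t\<close> and \<open>y = \<alpha>\<close> this is the
  F-polynomial of the graph-associahedron, with \<open>y = \<alpha> - t\<close> its H-polynomial.
\<close>

definition h_sum :: "'r::idom \<Rightarrow> 'r \<Rightarrow> ('v \<times> 'v) set \<Rightarrow> 'v set \<Rightarrow> 'r" where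
  "h_sum x y E U = (\<Sum>c\<in>facial_preorders E U.
     x ^ (card (blocks c U) - 1) * y ^ (card U - card (blocks c U)))"

abbreviation h_polynomial :: "('v \<times> 'v) set \<Rightarrow> 'v set \<Rightarrow> int poly poly" where
  "h_polynomial \<equiv> h_sum var_t (var_\<alpha> - var_t)"

definition gamma_term :: "nat \<Rightarrow> nat \<Rightarrow> int poly poly" where
  "gamma_term d i = (var_\<alpha> * var_t) ^ i * (var_\<alpha> + var_t) ^ (d - 2 * i)"

text \<open>
  The homogeneous polynomials of degree \<open>d\<close> with nonnegative gamma-vector, generated as a cone so
  that closure under products is an induction on the generators.
\<close>

inductive gamma_nonneg :: "nat \<Rightarrow> int poly poly \<Rightarrow> bool" for d where
  gamma_nonneg_0: "gamma_nonneg d 0"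
| gamma_nonneg_add_term: "gamma_nonneg d p \<Longrightarrow> 2 * i \<le> d \<Longrightarrow> gamma_nonneg d (p + gamma_term d i)"

lemma gamma_nonneg_term: "2 * i \<le> d \<Longrightarrow> gamma_nonneg d (gamma_term d i)"
  using gamma_nonneg_add_term[OF gamma_nonneg_0] by simp

lemma gamma_nonneg_add: "gamma_nonneg d p \<Longrightarrow> gamma_nonneg d q \<Longrightarrow> gamma_nonneg d (p + q)"
proof (induction rule: gamma_nonneg.induct)
  case gamma_nonneg_0
  then show ?case by simp
next
  case (gamma_nonneg_add_term p i)
  have "p + gamma_term d i + q = (p + q) + gamma_term d i" by simp
  then show ?case using gamma_nonneg_add_term by (metis gamma_nonneg.gamma_nonneg_add_term)
qed

lemma gamma_term_mult:
  assumes "2 * i \<le> d" "2 * j \<le> e"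
  shows "gamma_term d i * gamma_term e j = gamma_term (d + e) (i + j)"
proof -
  have "d + e - 2 * (i + j) = (d - 2 * i) + (e - 2 * j)" using assms by simp
  then show ?thesis unfolding gamma_term_def by (simp only: power_add mult_ac)
qed

lemma gamma_nonneg_mult:
  assumes "gamma_nonneg d p" "gamma_nonneg e q"
  shows "gamma_nonneg (d + e) (p * q)"
  using assms(1)
proof (induction rule: gamma_nonneg.induct)
  case gamma_nonneg_0
  then show ?case by (simp add: gamma_nonneg.gamma_nonneg_0)
next
  case (gamma_nonneg_add_term p i)
  have "gamma_nonneg (d + e) (gamma_term d i * q)"
    using assms(2)
  proof (induction rule: gamma_nonneg.induct)
    case gamma_nonneg_0
    then show ?case by (simp add: gamma_nonneg.gamma_nonneg_0)
  next
    case (gamma_nonneg_add_term q j)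
    have "gamma_nonneg (d + e) (gamma_term d i * gamma_term e j)"
      using gamma_nonneg_add_term.hyps \<open>2 * i \<le> d\<close>
      by (subst gamma_term_mult) (auto intro: gamma_nonneg_term)
    then show ?case using gamma_nonneg_add_term.IH by (simp add: distrib_left gamma_nonneg_add)
  qed
  then show ?case using gamma_nonneg_add_term by (simp add: distrib_right gamma_nonneg_add)
qed

lemma gamma_nonneg_1: "gamma_nonneg 0 1"
  using gamma_nonneg_term[of 0 0] by (simp add: gamma_term_def)

lemma gamma_nonneg_alpha_t: "gamma_nonneg 2 (var_\<alpha> * var_t)"
  using gamma_nonneg_term[of 1 2] by (simp add: gamma_term_def)

lemma gamma_nonneg_alpha_plus_t: "gamma_nonneg 1 (var_\<alpha> + var_t)"
  using gamma_nonneg_term[of 0 1] by (simp add: gamma_term_def)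

lemma gamma_nonneg_sum:
  assumes "finite I" "\<And>i. i \<in> I \<Longrightarrow> \<exists>q. gamma_nonneg d q \<and> f i = c * q"
  shows "\<exists>q. gamma_nonneg d q \<and> sum f I = c * q"
  using assms
proof (induction I rule: finite_induct)
  case empty
  then show ?case using gamma_nonneg_0 by auto
next
  case (insert i I)
  obtain p where p: "gamma_nonneg d p" "f i = c * p" using insert by blast
  obtain q where q: "gamma_nonneg d q" "sum f I = c * q" using insert by blast
  have "sum f (insert i I) = c * (p + q)" using insert p q by (simp add: distrib_left)
  then show ?case using gamma_nonneg_add[OF p(1) q(1)] by blast
qed

section \<open>Adding edges increases the gamma-vector\<close>

lemma var_t_nonzero: "var_t \<noteq> 0" and var_\<alpha>_minus_var_t_nonzero: "var_\<alpha> - var_t \<noteq> 0"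
  by (auto simp: var_t_def var_\<alpha>_def)

lemma card_blocks_pos:
  assumes "finite U" "U \<noteq> {}"
  shows "card (blocks c U) > 0"
  using assms finite_blocks[of U c] by (auto simp: card_gt_0_iff blocks_def quotient_def)

lemma face_sum_eq_h_sum:
  assumes "finite U" "U \<noteq> {}"
  shows "face_sum x y E U = x * h_sum x y E U"
proof -
  have "x ^ card (blocks c U) = x * x ^ (card (blocks c U) - 1)" for c
    using card_blocks_pos[OF assms, of c] by (metis power_eq_if neq0_conv)
  then show ?thesis unfolding face_sum_def h_sum_def by (simp add: sum_distrib_left mult.assoc)
qed

lemma h_sum_cong: "Restr E U = Restr E' U \<Longrightarrow> h_sum x y E U = h_sum x y E' U"
  unfolding h_sum_def by (simp cong: facial_preorders_cong)

text \<open>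
  The recursion for \<open>{a}\<close> involves only the empty set and \<open>{a}\<close> itself.
\<close>

lemma h_sum_singleton:
  assumes "x \<noteq> 0" "y \<noteq> 0"
  shows "h_sum x y E {a} = 1"
proof -
  have "linked E {a}" by (auto simp: linked_def)
  then have "(x + y) * face_sum x y E {a} = x * (y + face_sum x y E {a})"
    by (subst face_sum_linked) (auto simp: Pow_insert)
  then have "y * (x * h_sum x y E {a}) = y * (x * 1)"
    using face_sum_eq_h_sum[of "{a}" x y E] by (simp add: algebra_simps)
  then show ?thesis using assms by simp
qed

text \<open>
  A set \<open>S\<close> other than \<open>U\<close> contributes three smaller connected graphs: the two parts of \<open>S\<close> and
  the reconnected graph on \<open>U - S\<close>. Each of their face sums carries one factor \<open>t\<close>, and the
  degrees \<open>|S\<^sub>1| - 1\<close>, \<open>|S\<^sub>2| - 1\<close>, \<open>|U - S| - 1\<close> add up to \<open>|U| - 3\<close>. The product with \<open>\<alpha> t\<close> is then of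
  degree \<open>|U| - 1\<close>, the dimension of the polytope of \<open>U\<close>.
\<close>

lemma joined_term_gamma_nonneg:
  fixes E :: "('v \<times> 'v) set"
  assumes sym: "sym E" and fin: "finite U" and lin: "linked (add_edge E u v) U"
    and IH: "\<forall>(F :: ('v \<times> 'v) set) W. sym F \<and> W \<noteq> {} \<and> finite W \<and> linked F W \<and>
      card W < card U \<longrightarrow> gamma_nonneg (card W - 1) (h_polynomial F W)"
  shows "\<exists>q. gamma_nonneg (card U - 1) (var_\<alpha> * var_t * q) \<and>
    (\<Sum>S\<in>joined E u v U - {U}. face_sum var_t (var_\<alpha> - var_t) E S *
      face_sum var_t (var_\<alpha> - var_t) (reconnect (add_edge E u v) S) (U - S)) = var_t ^ 3 * q"
proof -
  let ?E = "add_edge E u v"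
  let ?P = "face_sum var_t (var_\<alpha> - var_t)"
  have one: "3 \<le> card U \<and> (\<exists>q. gamma_nonneg (card U - 3) q \<and> ?P E S * ?P (reconnect ?E S) (U - S) = var_t ^ 3 * q)"
    if S: "S \<in> joined E u v U - {U}" for S
  proof -
    obtain A B where AB: "S = A \<union> B" "apart E A B" "A \<noteq> {}" "B \<noteq> {}" "linked E A" "linked E B"
      using joined_split[OF sym, of S] S by blast
    let ?C = "U - S"
    have C: "?C \<noteq> {}" "S \<subseteq> U" using S by (auto simp: joined_def)
    have f: "finite A" "finite B" "finite ?C" using C AB fin by (auto intro: finite_subset)
    have "card U = card S + card ?C"
      using card_Diff_subset[of S U] card_mono[of U S] C(2) fin f AB(1) by simp
    moreover have "card S = card A + card B"
      using AB f by (simp add: card_Un_disjoint apart_def)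
    ultimately have cU: "card U = card A + card B + card ?C" by simp
    have pos: "card A > 0" "card B > 0" "card ?C > 0" using AB C f by (auto simp: card_gt_0_iff)
    let ?h = h_polynomial
    let ?R = "reconnect ?E S"
    have "gamma_nonneg (card A - 1) (?h E A)" "gamma_nonneg (card B - 1) (?h E B)"
      by (intro IH[rule_format]; use AB f cU pos sym in auto)+
    moreover have "gamma_nonneg (card ?C - 1) (?h ?R ?C)"
      using C f cU pos linked_reconnect[OF lin, of S] sym_reconnect[OF sym_add_edge[OF sym], of u v S]
      by (intro IH[rule_format]) auto
    ultimately have "gamma_nonneg ((card A - 1) + (card B - 1) + (card ?C - 1)) (?h E A * ?h E B * ?h ?R ?C)"
      by (intro gamma_nonneg_mult)
    moreover have "(card A - 1) + (card B - 1) + (card ?C - 1) = card U - 3" using cU pos by simp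
    moreover have "?P E S * ?P ?R ?C = var_t ^ 3 * (?h E A * ?h E B * ?h ?R ?C)"
      unfolding AB(1) face_sum_apart[OF AB(2) f(1,2)] face_sum_eq_h_sum[OF f(1) AB(3)]
        face_sum_eq_h_sum[OF f(2) AB(4)] face_sum_eq_h_sum[OF f(3) C(1), unfolded AB(1)]
      by (simp add: power3_eq_cube)
    ultimately show ?thesis using cU pos by auto
  qed
  have finJ: "finite (joined E u v U - {U})" using finite_joined[OF fin, of E u v] by simp
  show ?thesis
  proof (cases "joined E u v U - {U} = {}")
    case True
    then show ?thesis by (intro exI[of _ 0]) (simp add: True gamma_nonneg_0)
  next
    case False
    then have c: "3 \<le> card U" using one by blast
    obtain q where q: "gamma_nonneg (card U - 3) q"
      "(\<Sum>S\<in>joined E u v U - {U}. ?P E S * ?P (reconnect ?E S) (U - S)) = var_t ^ 3 * q"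
      using gamma_nonneg_sum[OF finJ, of "card U - 3" "\<lambda>S. ?P E S * ?P (reconnect ?E S) (U - S)" "var_t ^ 3"]
        one by blast
    have "2 + (card U - 3) = card U - 1" using c by simp
    then have "gamma_nonneg (card U - 1) (var_\<alpha> * var_t * q)"
      using gamma_nonneg_mult[OF gamma_nonneg_alpha_t q(1)] by metis
    then show ?thesis using q(2) by blast
  qed
qed

text \<open>
  As \<open>x + y = \<alpha>\<close> for \<open>x = t\<close> and \<open>y = \<alpha> - t\<close>, cancelling \<open>t\<^sup>2\<close> in \<open>face_sum_add_edge\<close> leaves
  \<open>\<alpha> t\<close> times a sum of products of smaller H-polynomials as the difference.
\<close>

lemma h_polynomial_add_edge:
  fixes E :: "('v \<times> 'v) set"
  assumes sym: "sym E" and fin: "finite U" and ne: "U \<noteq> {}" and lin: "linked E U"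
    and IH: "\<forall>(F :: ('v \<times> 'v) set) W. sym F \<and> W \<noteq> {} \<and> finite W \<and> linked F W \<and>
      card W < card U \<longrightarrow> gamma_nonneg (card W - 1) (h_polynomial F W)"
  shows "gamma_nonneg (card U - 1) (h_polynomial (add_edge E u v) U - h_polynomial E U)"
proof -
  let ?E = "add_edge E u v"
  have lin': "linked ?E U" by (rule linked_mono[OF lin]) auto
  obtain q where q: "gamma_nonneg (card U - 1) (var_\<alpha> * var_t * q)"
    "(\<Sum>S\<in>joined E u v U - {U}. face_sum var_t (var_\<alpha> - var_t) E S *
      face_sum var_t (var_\<alpha> - var_t) (reconnect ?E S) (U - S)) = var_t ^ 3 * q"
    using joined_term_gamma_nonneg[OF sym fin lin' IH] by blast
  have J: "joined E u v U - {U} = joined E u v U" using lin by (auto simp: joined_def)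
  have "var_t * (var_t * h_polynomial ?E U) = var_t * (var_t * h_polynomial E U) + var_\<alpha> * (var_t ^ 3 * q)"
    using face_sum_add_edge[OF sym fin var_\<alpha>_minus_var_t_nonzero, of var_t u v] q(2)
    unfolding J face_sum_eq_h_sum[OF fin ne] by simp
  then have "var_t * var_t * (h_polynomial ?E U - h_polynomial E U) = var_t * var_t * (var_\<alpha> * var_t * q)"
    by (simp add: algebra_simps power3_eq_cube)
  then have "h_polynomial ?E U - h_polynomial E U = var_\<alpha> * var_t * q"
    using var_t_nonzero by simp
  then show ?thesis using q(1) by simp
qed

text \<open>
  Here \<open>U\<close> itself is among the joined sets. Its term combines with the face sum of the two
  components to \<open>(\<alpha> + t) H\<^sub>1 H\<^sub>2\<close>, the H-polynomial of the product of their polytopes with an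
  interval.
\<close>

lemma h_polynomial_add_bridge:
  fixes E :: "('v \<times> 'v) set"
  assumes sym: "sym E" and fin: "finite U" and ne: "u \<in> U" "v \<in> U" and lin: "linked (add_edge E u v) U"
    and nlin: "\<not> linked E U"
    and IH: "\<forall>(F :: ('v \<times> 'v) set) W. sym F \<and> W \<noteq> {} \<and> finite W \<and> linked F W \<and>
      card W < card U \<longrightarrow> gamma_nonneg (card W - 1) (h_polynomial F W)"
  shows "gamma_nonneg (card U - 1) (h_polynomial (add_edge E u v) U)"
proof -
  let ?E = "add_edge E u v"
  let ?P = "face_sum var_t (var_\<alpha> - var_t)"
  obtain q where q: "gamma_nonneg (card U - 1) (var_\<alpha> * var_t * q)"
    "(\<Sum>S\<in>joined E u v U - {U}. ?P E S * ?P (reconnect ?E S) (U - S)) = var_t ^ 3 * q"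
    using joined_term_gamma_nonneg[OF sym fin lin IH] by blast
  have UJ: "U \<in> joined E u v U" using lin nlin ne by (auto simp: joined_def)
  obtain A B where AB: "U = A \<union> B" "apart E A B" "A \<noteq> {}" "B \<noteq> {}" "linked E A" "linked E B"
    using joined_split[OF sym UJ] by blast
  have f: "finite A" "finite B" using AB fin by auto
  have cU: "card U = card A + card B" using AB f by (simp add: card_Un_disjoint apart_def)
  have pos: "card A > 0" "card B > 0" using AB f by (auto simp: card_gt_0_iff)
  let ?h = h_polynomial
  have neU: "U \<noteq> {}" using ne by auto
  have PU: "?P E U = var_t * var_t * (?h E A * ?h E B)"
    unfolding AB(1) face_sum_apart[OF AB(2) f] face_sum_eq_h_sum[OF f(1) AB(3)]
      face_sum_eq_h_sum[OF f(2) AB(4)] by simp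
  have "(\<Sum>S\<in>joined E u v U. ?P E S * ?P (reconnect ?E S) (U - S)) = ?P E U + var_t ^ 3 * q"
    by (subst sum.remove[OF finite_joined[OF fin] UJ]) (simp add: q(2))
  then have "var_t * ?P ?E U = var_t * ?P E U + var_\<alpha> * (?P E U + var_t ^ 3 * q)"
    using face_sum_add_edge[OF sym fin var_\<alpha>_minus_var_t_nonzero, of var_t u v] by simp
  then have "var_t * (var_t * ?h ?E U) =
      var_t * (var_t * var_t * (?h E A * ?h E B)) + var_\<alpha> * (var_t * var_t * (?h E A * ?h E B) + var_t ^ 3 * q)"
    using face_sum_eq_h_sum[OF fin neU, of var_t "var_\<alpha> - var_t" ?E] unfolding PU by (simp only:)
  then have "var_t * var_t * ?h ?E U =
      var_t * var_t * ((var_\<alpha> + var_t) * (?h E A * ?h E B) + var_\<alpha> * var_t * q)"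
    by (simp add: algebra_simps power3_eq_cube)
  then have eq: "?h ?E U = (var_\<alpha> + var_t) * (?h E A * ?h E B) + var_\<alpha> * var_t * q"
    using var_t_nonzero by simp
  have "gamma_nonneg (card A - 1) (?h E A)" "gamma_nonneg (card B - 1) (?h E B)"
    by (intro IH[rule_format]; use AB f cU pos sym in auto)+
  then have "gamma_nonneg (1 + ((card A - 1) + (card B - 1))) ((var_\<alpha> + var_t) * (?h E A * ?h E B))"
    by (intro gamma_nonneg_mult gamma_nonneg_alpha_plus_t)
  moreover have "1 + ((card A - 1) + (card B - 1)) = card U - 1" using cU pos by simp
  ultimately show ?thesis unfolding eq using q(1) gamma_nonneg_add by metis
qed

text \<open>
  By induction on the number of vertices and then of edges: any edge of the graph is either
  a bridge, and then the graph falls apart into smaller ones, or it can be removed without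
  disconnecting the graph.
\<close>

theorem h_polynomial_gamma_nonneg:
  fixes E :: "('v \<times> 'v) set"
  assumes "sym E" "U \<noteq> {}" "finite U" "linked E U"
  shows "gamma_nonneg (card U - 1) (h_polynomial E U)"
  using assms
proof (induction "card U" arbitrary: E U rule: less_induct)
  case (less U E)
  have fin: "finite U" by fact
  have IH: "\<forall>(F :: ('v \<times> 'v) set) W. sym F \<and> W \<noteq> {} \<and> finite W \<and> linked F W \<and>
      card W < card U \<longrightarrow> gamma_nonneg (card W - 1) (h_polynomial F W)"
    using less.hyps by blast
  show ?case using less.prems(1,4)
  proof (induction "card (Restr E U)" arbitrary: E rule: less_induct)
    case (less E)
    show ?case
    proof (cases "\<exists>a. U = {a}")
      case True
      then show ?thesis
        using gamma_nonneg_1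
        by (auto simp: h_sum_singleton var_t_nonzero var_\<alpha>_minus_var_t_nonzero simp del: right_minus_eq)
    next
      case False
      obtain a b where ab: "a \<in> U" "b \<in> U" "a \<noteq> b" using False \<open>U \<noteq> {}\<close> by blast
      have "\<exists>u v. (u, v) \<in> Restr E U \<and> u \<noteq> v"
      proof (rule ccontr)
        assume *: "\<not> ?thesis"
        have "a = c" if "(a, c) \<in> (Restr E U)\<^sup>*" for c
          using that by (induction rule: rtrancl_induct) (use * in auto)
        then show False using less.prems(2) ab by (auto simp: linked_def)
      qed
      then obtain u v where uv: "(u, v) \<in> E" "u \<in> U" "v \<in> U" "u \<noteq> v" by blast
      define F where "F = E - {(u, v), (v, u)}"
      have symF: "sym F" using less.prems(1) by (auto simp: F_def sym_def)
      have E: "E = add_edge F u v" using uv less.prems(1) by (auto simp: F_def sym_def)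
      show ?thesis
      proof (cases "linked F U")
        case True
        have "Restr F U \<subset> Restr E U" using uv by (auto simp: F_def)
        then have "card (Restr F U) < card (Restr E U)" using fin by (intro psubset_card_mono) auto
        then have "gamma_nonneg (card U - 1) (h_polynomial F U)"
          using less.hyps symF True by blast
        moreover have "gamma_nonneg (card U - 1) (h_polynomial E U - h_polynomial F U)"
          unfolding E by (rule h_polynomial_add_edge[OF symF fin \<open>U \<noteq> {}\<close> True IH])
        ultimately show ?thesis using gamma_nonneg_add by fastforce
      next
        case False
        then show ?thesis
          unfolding E using h_polynomial_add_bridge[OF symF fin uv(2,3) _ False IH] less.prems(2) E by metis
      qed
    qed
  qed
qed

theorem h_polynomial_mono:
  assumes "sym E" "sym E'" "E \<subseteq> E'" "finite U" "U \<noteq> {}" "linked E U"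
  shows "gamma_nonneg (card U - 1) (h_polynomial E' U - h_polynomial E U)"
  using assms(1,3,6)
proof (induction "card (Restr E' U - E)" arbitrary: E rule: less_induct)
  case (less E)
  show ?case
  proof (cases "Restr E' U \<subseteq> E")
    case True
    then have "Restr E' U = Restr E U" using less.prems by auto
    then have "h_polynomial E' U = h_polynomial E U" by (rule h_sum_cong)
    then show ?thesis by (simp add: gamma_nonneg_0)
  next
    case False
    then obtain u v where uv: "(u, v) \<in> Restr E' U" "(u, v) \<notin> E" by auto
    let ?F = "add_edge E u v"
    have F: "sym ?F" "?F \<subseteq> E'" "linked ?F U"
      using less.prems(2) uv assms(2) sym_add_edge[OF less.prems(1)]
      by (auto dest: symD intro: linked_mono[OF less.prems(3)])
    have "Restr E' U - ?F \<subset> Restr E' U - E" using uv by auto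
    then have "card (Restr E' U - ?F) < card (Restr E' U - E)"
      using assms(4) by (intro psubset_card_mono) auto
    then have "gamma_nonneg (card U - 1) (h_polynomial E' U - h_polynomial ?F U)"
      using less.hyps F by blast
    moreover have "gamma_nonneg (card U - 1) (h_polynomial ?F U - h_polynomial E U)"
      by (intro h_polynomial_add_edge less.prems assms(4,5)) (auto intro: h_polynomial_gamma_nonneg[simplified])
    ultimately show ?thesis using gamma_nonneg_add by fastforce
  qed
qed

section \<open>Faces of a graph-associahedron\<close>

text \<open>
  The coordinates of the ambient space are indexed by \<open>V\<close> through \<open>e\<close>, so that every weight on \<open>V\<close>
  is the restriction of a linear functional.
\<close>

locale graph_polytope =
  fixes e :: "'v \<Rightarrow> 'a::euclidean_space" and E :: "('v \<times> 'v) set" and V :: "'v set"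
  assumes finite_V: "finite V" and basis: "bij_betw e V Basis" and sym_E: "sym E"
begin

definition tubes :: "'v set set" where
  "tubes = {S. S \<noteq> {} \<and> S \<subseteq> V \<and> linked E S}"

definition associahedron :: "'a set" where
  "associahedron = (\<Sum>S\<in>tubes. convex hull (e ` S))"

definition weight :: "'a \<Rightarrow> 'v \<Rightarrow> real" where
  "weight a i = a \<bullet> e i"

definition peaks :: "('v \<Rightarrow> real) \<Rightarrow> 'v set \<Rightarrow> 'v set" where
  "peaks w S = {j\<in>S. \<forall>k\<in>S. w k \<le> w j}"

definition height :: "'a \<Rightarrow> 'v set \<Rightarrow> real" where
  "height a S = Max (weight a ` S)"

definition face_in :: "'a \<Rightarrow> 'a set" where
  "face_in a = associahedron \<inter> {x. a \<bullet> x = (\<Sum>S\<in>tubes. height a S)}"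

lemma finite_tubes: "finite tubes"
  unfolding tubes_def using finite_V by auto

lemma tubeD: "S \<in> tubes \<Longrightarrow> finite S \<and> S \<noteq> {} \<and> S \<subseteq> V"
  unfolding tubes_def using finite_V finite_subset by blast

text \<open>
  The connected set behind \<open>i \<le> j\<close> is the set of all vertices that can be reached from \<open>i\<close> through
  vertices no heavier than \<open>j\<close>.
\<close>

lemma facial_preorder_iff_peak:
  "(i, j) \<in> facial_preorder E w V \<longleftrightarrow> (\<exists>S\<in>tubes. i \<in> S \<and> j \<in> peaks w S)"
proof
  assume ij: "(i, j) \<in> facial_preorder E w V"
  let ?X = "{k\<in>V. w k \<le> w j}"
  let ?S = "{k. (i, k) \<in> (Restr E ?X)\<^sup>*}"
  have i: "i \<in> ?X" using ij facial_preorder_le[OF ij] by (auto simp: facial_preorder_def)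
  have S: "?S \<subseteq> ?X" using rtrancl_Restr_in[of i _ E ?X] i by blast
  have reach: "(i, k) \<in> (Restr E ?S)\<^sup>*" if "k \<in> ?S" for k
  proof -
    have "(i, k) \<in> (Restr E ?X)\<^sup>*" using that by simp
    then show ?thesis
    proof (induction rule: rtrancl_induct)
      case base
      then show ?case by simp
    next
      case (step k l)
      then have "k \<in> ?S" "l \<in> ?S" by (auto intro: rtrancl.rtrancl_into_rtrancl)
      then have "(k, l) \<in> Restr E ?S" using step.hyps(2) by blast
      then show ?case using step.IH by (rule rtrancl.rtrancl_into_rtrancl[rotated])
    qed
  qed
  have "sym ((Restr E ?S)\<^sup>*)"
    by (rule sym_rtrancl) (use sym_E in \<open>auto simp: sym_def\<close>)
  then have "linked E ?S" unfolding linked_def using reach by (meson rtrancl_trans symD)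
  then have "?S \<in> tubes" using S i by (auto simp: tubes_def)
  moreover have "j \<in> ?S" using ij by (simp add: facial_preorder_def)
  then have "j \<in> peaks w ?S" using S by (auto simp: peaks_def)
  moreover have "i \<in> ?S" by simp
  ultimately show "\<exists>S\<in>tubes. i \<in> S \<and> j \<in> peaks w S" by (intro bexI[of _ ?S] conjI)
next
  assume "\<exists>S\<in>tubes. i \<in> S \<and> j \<in> peaks w S"
  then obtain S where S: "S \<in> tubes" "i \<in> S" "j \<in> peaks w S" by blast
  then have "(i, j) \<in> (Restr E S)\<^sup>*" by (auto simp: tubes_def linked_def peaks_def)
  moreover have "S \<subseteq> {k\<in>V. w k \<le> w j}" using S tubeD[OF S(1)] by (auto simp: peaks_def)
  ultimately show "(i, j) \<in> facial_preorder E w V"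
    using S by (auto simp: facial_preorder_def peaks_def elim!: rtrancl_Restr_mono)
qed

lemma peaks_eq_iff_facial_preorder_eq:
  "(\<forall>S\<in>tubes. peaks w S = peaks w' S) \<longleftrightarrow> facial_preorder E w V = facial_preorder E w' V"
proof
  assume "\<forall>S\<in>tubes. peaks w S = peaks w' S"
  then have "(i, j) \<in> facial_preorder E w V \<longleftrightarrow> (i, j) \<in> facial_preorder E w' V" for i j
    unfolding facial_preorder_iff_peak by auto
  then show "facial_preorder E w V = facial_preorder E w' V" by auto
next
  have sub: "peaks w S \<subseteq> peaks w' S"
    if "facial_preorder E w V = facial_preorder E w' V" "S \<in> tubes" for w w' S
  proof
    fix j assume j: "j \<in> peaks w S"
    then have "(k, j) \<in> facial_preorder E w' V" if "k \<in> S" for k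
      using that \<open>S \<in> tubes\<close> unfolding \<open>facial_preorder E w V = _\<close>[symmetric] facial_preorder_iff_peak
      by blast
    then show "j \<in> peaks w' S" using j facial_preorder_le by (fastforce simp: peaks_def)
  qed
  assume "facial_preorder E w V = facial_preorder E w' V"
  then show "\<forall>S\<in>tubes. peaks w S = peaks w' S" using sub by (metis subset_antisym)
qed

lemma weight_le_height: "S \<in> tubes \<Longrightarrow> i \<in> S \<Longrightarrow> weight a i \<le> height a S"
  unfolding height_def using tubeD[of S] by auto

lemma peaks_iff_height:
  assumes "S \<in> tubes"
  shows "j \<in> peaks (weight a) S \<longleftrightarrow> j \<in> S \<and> weight a j = height a S"
proof
  assume j: "j \<in> peaks (weight a) S"
  then have "height a S \<le> weight a j"
    unfolding height_def using tubeD[OF assms] by (auto simp: peaks_def)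
  then show "j \<in> S \<and> weight a j = height a S"
    using j weight_le_height[OF assms, of j a] by (auto simp: peaks_def)
next
  assume "j \<in> S \<and> weight a j = height a S"
  then show "j \<in> peaks (weight a) S" using weight_le_height[OF assms] by (auto simp: peaks_def)
qed

lemma peaks_nonempty:
  assumes "S \<in> tubes"
  obtains j where "j \<in> peaks (weight a) S"
proof -
  have "height a S \<in> weight a ` S"
    unfolding height_def using tubeD[OF assms] by (intro Lattices_Big.Max_in) auto
  then show ?thesis using that peaks_iff_height[OF assms] by auto
qed

lemma inner_le_height:
  assumes "S \<in> tubes" "x \<in> convex hull (e ` S)"
  shows "a \<bullet> x \<le> height a S"
proof -
  have "convex hull (e ` S) \<subseteq> {x. a \<bullet> x \<le> height a S}"
    using weight_le_height[OF assms(1)]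
    by (intro hull_minimal) (auto simp: weight_def convex_halfspace_le)
  then show ?thesis using assms(2) by auto
qed

text \<open>
  The points of a simplex that maximise a functional form a face, and a face of a convex hull is
  spanned by some of the given points.
\<close>

lemma hull_peaks:
  assumes S: "S \<in> tubes" and x: "x \<in> convex hull (e ` S)" "a \<bullet> x = height a S"
  shows "x \<in> convex hull (e ` peaks (weight a) S)"
proof -
  let ?T = "convex hull (e ` S) \<inter> {y. a \<bullet> y = height a S}"
  have "?T face_of convex hull (e ` S)"
    by (rule face_of_Int_supporting_hyperplane_le) (use inner_le_height[OF S] in auto)
  moreover have "compact (e ` S)" using tubeD[OF S] by (intro finite_imp_compact) auto
  ultimately obtain K where K: "K \<subseteq> e ` S" "?T = convex hull K"
    using face_of_convex_hull_subset by blast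
  have "K \<subseteq> e ` peaks (weight a) S"
  proof
    fix y assume "y \<in> K"
    then have "y \<in> ?T" unfolding K(2) by (rule hull_inc)
    moreover obtain i where "i \<in> S" "y = e i" using \<open>y \<in> K\<close> K(1) by auto
    ultimately show "y \<in> e ` peaks (weight a) S" using peaks_iff_height[OF S] by (auto simp: weight_def)
  qed
  then have "convex hull K \<subseteq> convex hull (e ` peaks (weight a) S)" by (rule hull_mono)
  moreover have "x \<in> convex hull K" using x K(2) by blast
  ultimately show ?thesis by blast
qed

lemma associahedron_mem:
  "x \<in> associahedron \<longleftrightarrow> (\<exists>s. x = sum s tubes \<and> (\<forall>S\<in>tubes. s S \<in> convex hull (e ` S)))"
  unfolding associahedron_def set_sum_alt[OF finite_tubes] by auto

lemma inner_associahedron_le: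
  assumes "x \<in> associahedron"
  shows "a \<bullet> x \<le> (\<Sum>S\<in>tubes. height a S)"
proof -
  obtain s where "x = sum s tubes" "\<forall>S\<in>tubes. s S \<in> convex hull (e ` S)"
    using assms unfolding associahedron_mem by blast
  then show ?thesis by (auto simp: inner_sum_right intro!: sum_mono inner_le_height)
qed

text \<open>
  A functional is maximal at a point of a Minkowski sum if and only if it is maximal at
  each summand.
\<close>

lemma face_in_sum_iff:
  assumes "\<forall>S\<in>tubes. s S \<in> convex hull (e ` S)"
  shows "sum s tubes \<in> face_in a \<longleftrightarrow> (\<forall>S\<in>tubes. a \<bullet> s S = height a S)"
proof
  assume "sum s tubes \<in> face_in a"
  then have "(\<Sum>S\<in>tubes. a \<bullet> s S) = (\<Sum>S\<in>tubes. height a S)"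
    by (simp add: face_in_def inner_sum_right)
  then show "\<forall>S\<in>tubes. a \<bullet> s S = height a S"
    using sum_mono_inv[of "\<lambda>S. a \<bullet> s S" tubes "height a"] inner_le_height assms finite_tubes by blast
next
  assume "\<forall>S\<in>tubes. a \<bullet> s S = height a S"
  then have "a \<bullet> sum s tubes = (\<Sum>S\<in>tubes. height a S)" by (simp add: inner_sum_right)
  then show "sum s tubes \<in> face_in a" using assms associahedron_mem by (auto simp: face_in_def)
qed

lemma e_in_hull: "i \<in> S \<Longrightarrow> e i \<in> convex hull (e ` S)"
  by (simp add: hull_inc)

lemma sum_peaks_in_face:
  assumes "\<And>S. S \<in> tubes \<Longrightarrow> p S \<in> peaks (weight a) S"
  shows "(\<Sum>S\<in>tubes. e (p S)) \<in> face_in a"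
proof (subst face_in_sum_iff)
  show "\<forall>S\<in>tubes. e (p S) \<in> convex hull (e ` S)" using assms e_in_hull by (auto simp: peaks_def)
  show "\<forall>S\<in>tubes. a \<bullet> e (p S) = height a S" using assms peaks_iff_height by (auto simp: weight_def)
qed

definition peak :: "'a \<Rightarrow> 'v set \<Rightarrow> 'v" where
  "peak a S = (SOME j. j \<in> peaks (weight a) S)"

lemma peak: "S \<in> tubes \<Longrightarrow> peak a S \<in> peaks (weight a) S"
  unfolding peak_def by (meson peaks_nonempty someI)

lemma face_in_nonempty: "face_in a \<noteq> {}"
  using sum_peaks_in_face[of "peak a" a] peak by auto

lemma convex_associahedron: "convex associahedron"
  unfolding associahedron_def by (intro convex_set_sum convex_convex_hull)

lemma polytope_associahedron: "polytope associahedron"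
proof -
  have "associahedron = convex hull (\<Sum>S\<in>tubes. e ` S)"
    by (simp add: associahedron_def convex_hull_set_sum)
  moreover have "finite (\<Sum>S\<in>tubes. e ` S)"
    using tubeD by (intro finite_set_sum) auto
  ultimately show ?thesis unfolding polytope_def by blast
qed

text \<open>
  Faces of a polytope are exposed.
\<close>

lemma nonempty_faces: "{F. F face_of associahedron \<and> F \<noteq> {}} = range face_in"
proof (intro equalityI subsetI)
  fix F assume "F \<in> {F. F face_of associahedron \<and> F \<noteq> {}}"
  then have F: "F face_of associahedron" "F \<noteq> {}" by auto
  then have "F exposed_face_of associahedron"
    using exposed_face_of_polyhedron polytope_imp_polyhedron polytope_associahedron by blast
  then obtain a b where ab: "associahedron \<subseteq> {x. a \<bullet> x \<le> b}" "F = associahedron \<inter> {x. a \<bullet> x = b}"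
    unfolding exposed_face_of_def by auto
  obtain x where x: "x \<in> associahedron" "a \<bullet> x = b" using F(2) ab(2) by auto
  obtain y where y: "y \<in> associahedron" "a \<bullet> y = (\<Sum>S\<in>tubes. height a S)"
    using face_in_nonempty[of a] by (auto simp: face_in_def)
  have "b = (\<Sum>S\<in>tubes. height a S)"
    using inner_associahedron_le[OF x(1), of a] x(2) y ab(1) by (intro antisym) auto
  then have "F = face_in a" unfolding face_in_def ab(2) by blast
  then show "F \<in> range face_in" by blast
next
  fix F assume "F \<in> range face_in"
  then obtain a where F: "F = face_in a" by blast
  have "face_in a face_of associahedron" unfolding face_in_def
    by (rule face_of_Int_supporting_hyperplane_le[OF convex_associahedron]) (rule inner_associahedron_le)
  then show "F \<in> {F. F face_of associahedron \<and> F \<noteq> {}}" using F face_in_nonempty by auto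
qed

text \<open>
  Points of a face can be changed in one summand at a time, so the face knows the maximal
  vertices of every tube, and these know the preorder.
\<close>

lemma face_in_eq_iff:
  "face_in a = face_in b \<longleftrightarrow> facial_preorder E (weight a) V = facial_preorder E (weight b) V"
proof
  have sub: "peaks (weight a) S \<subseteq> peaks (weight b) S"
    if eq: "face_in a = face_in b" and S: "S \<in> tubes" for a b S
  proof
    fix j assume j: "j \<in> peaks (weight a) S"
    define p where "p = (peak a)(S := j)"
    have p: "p T \<in> peaks (weight a) T" if "T \<in> tubes" for T
      using that j peak by (auto simp: p_def)
    then have "(\<Sum>T\<in>tubes. e (p T)) \<in> face_in b" using sum_peaks_in_face[of p a] eq by simp
    moreover have "\<forall>T\<in>tubes. e (p T) \<in> convex hull (e ` T)"
      using p e_in_hull by (auto simp: peaks_def)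
    ultimately have "b \<bullet> e (p S) = height b S" using face_in_sum_iff[of "\<lambda>T. e (p T)" b] S by blast
    then show "j \<in> peaks (weight b) S"
      using peaks_iff_height[OF S] j by (auto simp: p_def weight_def peaks_def)
  qed
  assume "face_in a = face_in b"
  then have "\<forall>S\<in>tubes. peaks (weight a) S = peaks (weight b) S" using sub by (metis subset_antisym)
  then show "facial_preorder E (weight a) V = facial_preorder E (weight b) V"
    unfolding peaks_eq_iff_facial_preorder_eq .
next
  have sub: "face_in a \<subseteq> face_in b"
    if eq: "\<forall>S\<in>tubes. peaks (weight a) S = peaks (weight b) S" for a b
  proof
    fix x assume x: "x \<in> face_in a"
    then obtain s where s: "x = sum s tubes" "\<forall>S\<in>tubes. s S \<in> convex hull (e ` S)"
      unfolding face_in_def using associahedron_mem by auto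
    have "b \<bullet> s S = height b S" if S: "S \<in> tubes" for S
    proof -
      have "a \<bullet> s S = height a S" using x s face_in_sum_iff S by blast
      then have "s S \<in> convex hull (e ` peaks (weight b) S)" using hull_peaks s S eq by metis
      moreover have "convex hull (e ` peaks (weight b) S) \<subseteq> {y. b \<bullet> y = height b S}"
        using peaks_iff_height[OF S, of _ b]
        by (intro hull_minimal) (auto simp: weight_def convex_hyperplane)
      ultimately show ?thesis by auto
    qed
    then show "x \<in> face_in b" using s face_in_sum_iff by blast
  qed
  assume "facial_preorder E (weight a) V = facial_preorder E (weight b) V"
  then have "\<forall>S\<in>tubes. peaks (weight a) S = peaks (weight b) S"
    unfolding peaks_eq_iff_facial_preorder_eq .
  then show "face_in a = face_in b" using sub by (metis subset_antisym)
qed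

lemma inner_e: "i \<in> V \<Longrightarrow> j \<in> V \<Longrightarrow> e i \<bullet> e j = (if i = j then 1 else 0)"
proof -
  assume ij: "i \<in> V" "j \<in> V"
  then have "e i \<in> Basis" "e j \<in> Basis" using bij_betw_apply[OF basis] by auto
  moreover have "e i = e j \<longleftrightarrow> i = j"
    using inj_on_eq_iff[OF bij_betw_imp_inj_on[OF basis] ij] .
  ultimately show ?thesis using inner_Basis[of "e i" "e j"] by simp
qed

lemma expand: "x = (\<Sum>i\<in>V. (x \<bullet> e i) *\<^sub>R e i)"
  using euclidean_representation[of x] sum.reindex_bij_betw[OF basis, of "\<lambda>b. (x \<bullet> b) *\<^sub>R b"] by simp

lemma card_V: "card V = DIM('a)"
  using bij_betw_same_card[OF basis] by simp

lemma facial_preorders_eq: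
  "facial_preorders E V = range (\<lambda>a. facial_preorder E (weight a) V)"
proof -
  have "\<exists>a. facial_preorder E w V = facial_preorder E (weight a) V" for w
  proof
    have "weight (\<Sum>i\<in>V. w i *\<^sub>R e i) j = w j" if "j \<in> V" for j
      using that finite_V by (simp add: weight_def inner_sum_left inner_e if_distrib cong: if_cong)
    then show "facial_preorder E w V = facial_preorder E (weight (\<Sum>i\<in>V. w i *\<^sub>R e i)) V"
      by (intro facial_preorder_cong) auto
  qed
  then show ?thesis unfolding facial_preorders_def by (intro equalityI subsetI) (blast, blast)
qed

definition block_sum :: "'v set \<Rightarrow> 'a" where
  "block_sum R = (\<Sum>i\<in>R. e i)"

text \<open>
  Two equivalent vertices are both heaviest in a common tube \<open>S\<close>, so moving the summand of \<open>S\<close>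
  from one to the other stays in the face. Conversely all heaviest vertices of a tube are
  equivalent.
\<close>

lemma orthogonal_to_face_iff:
  fixes a b :: 'a defines "c \<equiv> facial_preorder E (weight a) V"
  shows "(\<forall>x\<in>face_in a. \<forall>y\<in>face_in a. b \<bullet> x = b \<bullet> y) \<longleftrightarrow>
    (\<forall>i j. (i, j) \<in> c \<inter> c\<inverse> \<longrightarrow> b \<bullet> e i = b \<bullet> e j)"
proof (intro iffI allI impI ballI)
  fix i j assume const: "\<forall>x\<in>face_in a. \<forall>y\<in>face_in a. b \<bullet> x = b \<bullet> y" and ij: "(i, j) \<in> c \<inter> c\<inverse>"
  obtain S where S: "S \<in> tubes" "i \<in> S" "j \<in> peaks (weight a) S"
    using ij facial_preorder_iff_peak by (auto simp: c_def)
  have "weight a j \<le> weight a i" using ij facial_preorder_le by (auto simp: c_def)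
  then have iS: "i \<in> peaks (weight a) S" using S by (force simp: peaks_def)
  \<comment> \<open>Two points of the face that differ only in their summand from \<open>S\<close>.\<close>
  have in_face: "(\<Sum>T\<in>tubes. e (((peak a)(S := k)) T)) \<in> face_in a" if "k \<in> peaks (weight a) S" for k
    by (rule sum_peaks_in_face) (use that peak in auto)
  have split: "(\<Sum>T\<in>tubes. e (((peak a)(S := k)) T)) = e k + (\<Sum>T\<in>tubes - {S}. e (peak a T))" for k
    by (subst sum.remove[OF finite_tubes S(1)]) (auto intro: sum.cong)
  show "b \<bullet> e i = b \<bullet> e j"
    using const in_face[OF iS] in_face[OF S(3)] unfolding split by (fastforce simp: inner_add_right)
next
  fix x y assume const: "\<forall>i j. (i, j) \<in> c \<inter> c\<inverse> \<longrightarrow> b \<bullet> e i = b \<bullet> e j"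
    and xy: "x \<in> face_in a" "y \<in> face_in a"
  have val: "b \<bullet> z = (\<Sum>S\<in>tubes. b \<bullet> e (peak a S))" if z: "z \<in> face_in a" for z
  proof -
    obtain s where s: "z = sum s tubes" "\<forall>S\<in>tubes. s S \<in> convex hull (e ` S)"
      using z unfolding face_in_def using associahedron_mem by auto
    have "b \<bullet> s S = b \<bullet> e (peak a S)" if S: "S \<in> tubes" for S
    proof -
      have "a \<bullet> s S = height a S" using z s face_in_sum_iff S by blast
      then have "s S \<in> convex hull (e ` peaks (weight a) S)" using hull_peaks s S by metis
      moreover have "b \<bullet> e i = b \<bullet> e (peak a S)" if i: "i \<in> peaks (weight a) S" for i
      proof -
        have "i \<in> S" "peak a S \<in> S" using i peak[OF S] by (auto simp: peaks_def)
        then have "(i, peak a S) \<in> c \<inter> c\<inverse>"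
          using S i peak[OF S, of a] facial_preorder_iff_peak unfolding c_def by blast
        then show ?thesis using const by blast
      qed
      then have "convex hull (e ` peaks (weight a) S) \<subseteq> {y. b \<bullet> y = b \<bullet> e (peak a S)}"
        by (intro hull_minimal) (auto simp: convex_hyperplane)
      ultimately show ?thesis by auto
    qed
    then show ?thesis using s by (simp add: inner_sum_right)
  qed
  show "b \<bullet> x = b \<bullet> y" using val xy by simp
qed

text \<open>
  The sums of basis vectors over the blocks form an orthogonal basis of this space.
\<close>

lemma dim_constant_on_blocks:
  assumes eq: "equiv V r"
  shows "dim {b. \<forall>i j. (i, j) \<in> r \<longrightarrow> b \<bullet> e i = b \<bullet> e j} = card (V // r)"
proof -
  let ?W = "{b. \<forall>i j. (i, j) \<in> r \<longrightarrow> b \<bullet> e i = b \<bullet> e j}"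
  have sub: "R \<subseteq> V" "finite R" if "R \<in> V // r" for R
    using that finite_V in_quotient_imp_subset[OF eq] finite_subset by blast+
  have ind: "block_sum R \<bullet> e i = (if i \<in> R then 1 else 0)" if "R \<in> V // r" "i \<in> V" for R i
  proof -
    have "block_sum R \<bullet> e i = (\<Sum>k\<in>R. if k = i then 1 else 0)"
      unfolding block_sum_def inner_sum_left
      using sub[OF that(1)] that(2) by (intro sum.cong) (auto simp: inner_e)
    then show ?thesis using sub[OF that(1)] by simp
  qed
  have ne: "R \<noteq> {}" if "R \<in> V // r" for R using that in_quotient_imp_non_empty[OF eq] by blast
  have disj: "R \<inter> R' = {}" if "R \<in> V // r" "R' \<in> V // r" "R \<noteq> R'" for R R'
    using quotient_disj[OF eq] that by blast
  have nz: "block_sum R \<noteq> 0" if R: "R \<in> V // r" for R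
  proof -
    obtain i where "i \<in> R" using ne[OF R] by auto
    then have "block_sum R \<bullet> e i = 1" using ind[OF R, of i] sub[OF R] by auto
    then show ?thesis by auto
  qed
  have orth: "block_sum R \<bullet> block_sum R' = 0" if R: "R \<in> V // r" "R' \<in> V // r" "R \<noteq> R'" for R R'
  proof -
    have "block_sum R \<bullet> block_sum R' = (\<Sum>k\<in>R'. block_sum R \<bullet> e k)"
      unfolding block_sum_def[of R'] by (simp add: inner_sum_right)
    also have "\<dots> = 0"
    proof (intro sum.neutral ballI)
      fix k assume "k \<in> R'"
      then have "k \<in> V" "k \<notin> R" using sub[OF R(2)] disj[OF R] by auto
      then show "block_sum R \<bullet> e k = 0" using ind[OF R(1)] by simp
    qed
    finally show ?thesis .
  qed
  have inj: "inj_on block_sum (V // r)"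
  proof (rule inj_onI)
    fix R R' assume R: "R \<in> V // r" "R' \<in> V // r" "block_sum R = block_sum R'"
    show "R = R'"
    proof (rule ccontr)
      assume "R \<noteq> R'"
      then have "block_sum R' \<bullet> block_sum R' = 0" using orth[OF R(1,2)] R(3) by simp
      then show False using nz[OF R(2)] by simp
    qed
  qed
  have indep: "independent (block_sum ` (V // r))"
    by (rule pairwise_orthogonal_independent)
       (use nz orth in \<open>auto simp: pairwise_def orthogonal_def\<close>)
  have "?W = span (block_sum ` (V // r))"
  proof
    have "subspace ?W" by (auto simp: subspace_def inner_add_left)
    moreover have "block_sum ` (V // r) \<subseteq> ?W"
    proof clarify
      fix R i j assume R: "R \<in> V // r" and ij: "(i, j) \<in> r"
      then have V: "i \<in> V" "j \<in> V" using eq by (auto simp: equiv_def)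
      have "i \<in> R \<longleftrightarrow> j \<in> R" using in_quotient_imp_closed[OF eq R] ij eq
        by (meson equivE symD)
      then show "block_sum R \<bullet> e i = block_sum R \<bullet> e j" using ind R V by simp
    qed
    ultimately show "span (block_sum ` (V // r)) \<subseteq> ?W" by (simp add: span_minimal)
  next
    show "?W \<subseteq> span (block_sum ` (V // r))"
    proof
      fix b assume b: "b \<in> ?W"
      have "b = (\<Sum>i\<in>V. (b \<bullet> e i) *\<^sub>R e i)" by (rule expand)
      also have "\<dots> = (\<Sum>R\<in>V // r. \<Sum>i\<in>R. (b \<bullet> e i) *\<^sub>R e i)"
        using sum.Union_disjoint[of "V // r" "\<lambda>i. (b \<bullet> e i) *\<^sub>R e i"] sub disj Union_quotient[OF eq]
        by auto
      also have "\<dots> = (\<Sum>R\<in>V // r. (b \<bullet> e (SOME k. k \<in> R)) *\<^sub>R block_sum R)"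
      proof (rule sum.cong[OF refl])
        fix R assume R: "R \<in> V // r"
        have k: "(SOME k. k \<in> R) \<in> R" using ne[OF R] by (simp add: some_in_eq)
        have "b \<bullet> e i = b \<bullet> e (SOME k. k \<in> R)" if "i \<in> R" for i
          using b quotient_eq_iff[OF eq R R that k] by auto
        then show "(\<Sum>i\<in>R. (b \<bullet> e i) *\<^sub>R e i) = (b \<bullet> e (SOME k. k \<in> R)) *\<^sub>R block_sum R"
          unfolding block_sum_def scaleR_sum_right by (intro sum.cong) auto
      qed
      also have "\<dots> \<in> span (block_sum ` (V // r))"
        by (intro span_sum span_scale span_base) auto
      finally show "b \<in> span (block_sum ` (V // r))" .
    qed
  qed
  then have "dim ?W = card (block_sum ` (V // r))"
    using indep by (simp add: dim_eq_card_independent)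
  also have "\<dots> = card (V // r)" using inj by (rule card_image)
  finally show ?thesis .
qed

text \<open>
  The vectors orthogonal to the face are those that are constant on blocks, and the dimension of
  the face is that of the orthogonal complement of this space.
\<close>

lemma aff_dim_face_in:
  "aff_dim (face_in a) = int (card V - card (blocks (facial_preorder E (weight a) V) V))"
proof -
  let ?c = "facial_preorder E (weight a) V"
  obtain x0 where x0: "x0 \<in> face_in a" using face_in_nonempty by auto
  let ?D = "(\<lambda>x. x - x0) ` face_in a"
  have "{b. \<forall>d\<in>span ?D. orthogonal b d} = {b. \<forall>x\<in>face_in a. \<forall>y\<in>face_in a. b \<bullet> x = b \<bullet> y}"
  proof (intro equalityI subsetI)
    fix b assume "b \<in> {b. \<forall>d\<in>span ?D. orthogonal b d}"
    then have "\<forall>x\<in>face_in a. orthogonal b (x - x0)" by (auto simp: span_base)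
    then have "\<forall>x\<in>face_in a. b \<bullet> x = b \<bullet> x0" by (auto simp: orthogonal_def inner_diff_right)
    then show "b \<in> {b. \<forall>x\<in>face_in a. \<forall>y\<in>face_in a. b \<bullet> x = b \<bullet> y}" by auto
  next
    fix b assume b: "b \<in> {b. \<forall>x\<in>face_in a. \<forall>y\<in>face_in a. b \<bullet> x = b \<bullet> y}"
    have "orthogonal b d" if "d \<in> span ?D" for d
    proof (rule orthogonal_to_span[OF that])
      fix d assume "d \<in> ?D"
      then obtain x where x: "x \<in> face_in a" "d = x - x0" by blast
      then have "b \<bullet> x = b \<bullet> x0" using b x0 by blast
      then show "orthogonal b d" using x(2) by (simp add: orthogonal_def inner_diff_right)
    qed
    then show "b \<in> {b. \<forall>d\<in>span ?D. orthogonal b d}" by blast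
  qed
  also have "dim \<dots> = card (blocks ?c V)"
    unfolding orthogonal_to_face_iff blocks_def by (rule dim_constant_on_blocks[OF facial_preorder_equiv])
  finally have W: "dim {b. \<forall>d\<in>span ?D. orthogonal b d} = card (blocks ?c V)" .
  have "dim {b \<in> UNIV. \<forall>d\<in>span ?D. orthogonal d b} + dim (span ?D) = dim (UNIV :: 'a set)"
    by (rule dim_subspace_orthogonal_to_vectors) auto
  then have "dim ?D = card V - card (blocks ?c V)"
    using W by (simp add: card_V orthogonal_commute)
  then show ?thesis using aff_dim_eq_dim_subtract[of x0 "face_in a"] x0 by (simp add: hull_inc)
qed

lemma f_num_associahedron:
  "f_num associahedron i = card {c\<in>facial_preorders E V. card V - card (blocks c V) = i}"
proof -
  let ?c = "\<lambda>a. facial_preorder E (weight a) V"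
  define g where "g = (\<lambda>F. ?c (SOME a. F = face_in a))"
  have g: "g (face_in a) = ?c a" for a
    unfolding g_def using someI[of "\<lambda>b. face_in a = face_in b" a] face_in_eq_iff by auto
  have "{F. F face_of associahedron \<and> aff_dim F = int i} = {F\<in>range face_in. aff_dim F = int i}"
    unfolding nonempty_faces[symmetric] by (auto simp: aff_dim_empty)
  moreover have "bij_betw g {F\<in>range face_in. aff_dim F = int i}
      {c\<in>facial_preorders E V. card V - card (blocks c V) = i}"
  proof (rule bij_betw_imageI)
    show "inj_on g {F\<in>range face_in. aff_dim F = int i}"
    proof (rule inj_onI)
      fix F F' assume F: "F \<in> {F\<in>range face_in. aff_dim F = int i}"
        "F' \<in> {F\<in>range face_in. aff_dim F = int i}" "g F = g F'"
      then obtain a b where "F = face_in a" "F' = face_in b" by blast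
      then show "F = F'" using F(3) g face_in_eq_iff by simp
    qed
    show "g ` {F\<in>range face_in. aff_dim F = int i} = {c\<in>facial_preorders E V. card V - card (blocks c V) = i}"
    proof (intro equalityI subsetI)
      fix c assume "c \<in> g ` {F\<in>range face_in. aff_dim F = int i}"
      then show "c \<in> {c\<in>facial_preorders E V. card V - card (blocks c V) = i}"
        unfolding facial_preorders_eq by (auto simp: g aff_dim_face_in)
    next
      fix c assume "c \<in> {c\<in>facial_preorders E V. card V - card (blocks c V) = i}"
      then obtain a where "c = ?c a" "card V - card (blocks (?c a) V) = i"
        unfolding facial_preorders_eq by blast
      then have "c = g (face_in a)" "aff_dim (face_in a) = int i" by (simp_all add: g aff_dim_face_in)
      then show "c \<in> g ` {F\<in>range face_in. aff_dim F = int i}" by blast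
    qed
  qed
  ultimately show ?thesis unfolding f_num_def by (simp only: bij_betw_same_card)
qed

end

section \<open>Comparing face numbers\<close>

text \<open>
  The coefficient of \<open>\<alpha>\<^sup>a t\<^sup>b\<close>.
\<close>

definition coeff2 :: "int poly poly \<Rightarrow> nat \<Rightarrow> nat \<Rightarrow> int" where
  "coeff2 p a b = coeff (coeff p a) b"

lemma coeff2_add: "coeff2 (p + q) a b = coeff2 p a b + coeff2 q a b"
  and coeff2_diff: "coeff2 (p - q) a b = coeff2 p a b - coeff2 q a b"
  and coeff2_sum: "coeff2 (sum f I) a b = (\<Sum>i\<in>I. coeff2 (f i) a b)"
  and coeff2_0: "coeff2 0 a b = 0"
  by (simp_all add: coeff2_def coeff_sum)

lemma coeff2_of_int_mult: "coeff2 (of_int c * p) a b = c * coeff2 p a b"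
  by (simp add: coeff2_def of_int_poly)

lemma coeff2_of_nat_mult: "coeff2 (of_nat c * p) a b = int c * coeff2 p a b"
  using coeff2_of_int_mult[of "int c"] by simp

lemma coeff2_monomial: "coeff2 (var_\<alpha> ^ k * var_t ^ l) a b = (if a = k \<and> b = l then 1 else 0)"
proof -
  have "var_\<alpha> ^ k * var_t ^ l = monom (monom 1 l) k"
    by (simp add: var_\<alpha>_def var_t_def poly_const_pow monom_altdef)
  then show ?thesis by (simp add: coeff2_def)
qed

lemma gamma_term_expand:
  "gamma_term n j = (\<Sum>k\<le>n - 2 * j. of_nat ((n - 2 * j) choose k) * (var_\<alpha> ^ (k + j) * var_t ^ (n - 2 * j - k + j)))"
  unfolding gamma_term_def binomial_ring sum_distrib_left
  by (intro sum.cong refl) (simp add: power_mult_distrib power_add mult_ac)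

definition h_coeff :: "nat \<Rightarrow> int poly poly \<Rightarrow> nat \<Rightarrow> int" where
  "h_coeff n p i = coeff2 p (n - i) i"

lemma h_coeff_gamma_term:
  assumes "i \<le> n" "2 * j \<le> n"
  shows "h_coeff n (gamma_term n j) i = (if j \<le> i then int ((n - 2 * j) choose (i - j)) else 0)"
proof -
  let ?m = "n - 2 * j"
  have "h_coeff n (gamma_term n j) i =
      (\<Sum>k\<le>?m. int (?m choose k) * (if n - i = k + j \<and> i = ?m - k + j then 1 else 0))"
    by (simp add: h_coeff_def gamma_term_expand coeff2_sum coeff2_of_nat_mult coeff2_monomial)
  also have "\<dots> = (\<Sum>k\<le>?m. if k = ?m - (i - j) then (if j \<le> i \<and> i - j \<le> ?m then int (?m choose k) else 0) else 0)"
  proof (rule sum.cong[OF refl])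
    fix k assume "k \<in> {..?m}"
    then have "(n - i = k + j \<and> i = ?m - k + j) \<longleftrightarrow> (k = ?m - (i - j) \<and> j \<le> i \<and> i - j \<le> ?m)"
      using assms by (simp only: atMost_iff) arith
    then show "int (?m choose k) * (if n - i = k + j \<and> i = ?m - k + j then 1 else 0) =
        (if k = ?m - (i - j) then (if j \<le> i \<and> i - j \<le> ?m then int (?m choose k) else 0) else 0)"
      by simp
  qed
  also have "\<dots> = (if j \<le> i \<and> i - j \<le> ?m then int (?m choose (?m - (i - j))) else 0)"
    by (subst sum.delta) auto
  also have "\<dots> = (if j \<le> i then int (?m choose (i - j)) else 0)"
  proof (cases "i - j \<le> ?m")
    case True
    then have "?m choose (?m - (i - j)) = ?m choose (i - j)" by (rule binomial_symmetric[symmetric])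
    then show ?thesis using True by (simp only: simp_thms)
  next
    case False
    then show ?thesis by (simp add: binomial_eq_0)
  qed
  finally show ?thesis .
qed

lemma gamma_nonneg_expand:
  assumes "gamma_nonneg n p"
  obtains c :: "nat \<Rightarrow> int"
  where "\<And>j. 0 \<le> c j" "p = (\<Sum>j\<le>n div 2. of_int (c j) * gamma_term n j)"
proof -
  have "\<exists>c :: nat \<Rightarrow> int. (\<forall>j. 0 \<le> c j) \<and> p = (\<Sum>j\<le>n div 2. of_int (c j) * gamma_term n j)"
    using assms
  proof (induction rule: gamma_nonneg.induct)
    case gamma_nonneg_0
    show ?case by (intro exI[of _ "\<lambda>_. 0"]) simp
  next
    case (gamma_nonneg_add_term p i)
    then obtain c :: "nat \<Rightarrow> int" where c: "\<forall>j. 0 \<le> c j"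
      "p = (\<Sum>j\<le>n div 2. of_int (c j) * gamma_term n j)" by blast
    have "gamma_term n i = (\<Sum>j\<le>n div 2. if j = i then gamma_term n j else 0)"
      using gamma_nonneg_add_term.hyps(2) by simp
    then have "p + gamma_term n i =
        (\<Sum>j\<le>n div 2. of_int (c j) * gamma_term n j + (if j = i then gamma_term n j else 0))"
      unfolding c(2) sum.distrib by (rule arg_cong)
    also have "\<dots> = (\<Sum>j\<le>n div 2. of_int (c j + (if j = i then 1 else 0)) * gamma_term n j)"
      by (intro sum.cong) (auto simp: distrib_right)
    finally show ?case using c(1) by (intro exI[of _ "\<lambda>j. c j + (if j = i then 1 else 0)"]) auto
  qed
  then show ?thesis using that by blast
qed

lemma h_coeff_expand:
  "h_coeff n (\<Sum>j\<le>n div 2. of_int (c j) * gamma_term n j) i =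
    (\<Sum>j\<le>n div 2. c j * h_coeff n (gamma_term n j) i)"
  by (simp add: h_coeff_def coeff2_sum coeff2_of_int_mult)

text \<open>
  The matrix that expresses the h-numbers by the gamma-numbers is unitriangular.
\<close>

lemma gamma_coefficients_unique:
  assumes eq: "(\<Sum>j\<le>n div 2. of_int (c j) * gamma_term n j) = (\<Sum>j\<le>n div 2. of_int (d j) * gamma_term n j)"
    and i: "i \<le> n div 2"
  shows "c i = d i"
  using i
proof (induction i rule: less_induct)
  case (less i)
  have val: "h_coeff n (\<Sum>j\<le>n div 2. of_int (f j) * gamma_term n j) i =
      (\<Sum>j<i. f j * h_coeff n (gamma_term n j) i) + f i" for f
  proof -
    have "(\<Sum>j\<le>n div 2. f j * h_coeff n (gamma_term n j) i) =
        (\<Sum>j\<le>i. f j * h_coeff n (gamma_term n j) i)"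
      using less.prems by (intro sum.mono_neutral_right) (auto simp: h_coeff_gamma_term)
    moreover have "h_coeff n (gamma_term n i) i = 1" using less.prems by (simp add: h_coeff_gamma_term)
    ultimately show ?thesis unfolding h_coeff_expand by (simp add: lessThan_Suc_atMost[symmetric])
  qed
  have "(\<Sum>j<i. c j * h_coeff n (gamma_term n j) i) = (\<Sum>j<i. d j * h_coeff n (gamma_term n j) i)"
    using less by (intro sum.cong) auto
  then show ?case using val[of c] val[of d] eq by simp
qed

lemma gamma_num_eq:
  assumes dim: "poly_dim P = n"
    and H: "H_poly P = (\<Sum>j\<le>n div 2. of_int (c j) * gamma_term n j)" and i: "i \<le> n div 2"
  shows "gamma_num P i = c i"
proof -
  let ?c = "\<lambda>j. if j \<le> n div 2 then c j else 0"
  have form: "(\<Sum>j\<le>n div 2. of_int (\<gamma> j) * (var_\<alpha> * var_t) ^ j * (var_\<alpha> + var_t) ^ (n - 2 * j)) =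
      (\<Sum>j\<le>n div 2. of_int (\<gamma> j) * gamma_term n j)" for \<gamma> :: "nat \<Rightarrow> int"
    by (simp add: gamma_term_def mult.assoc)
  have "gamma_num P = ?c"
    unfolding gamma_num_def dim form
  proof (rule the_equality)
    show "(\<forall>i>n div 2. ?c i = 0) \<and> H_poly P = (\<Sum>j\<le>n div 2. of_int (?c j) * gamma_term n j)"
      unfolding H by (intro conjI allI impI sum.cong refl) auto
  next
    fix \<gamma> :: "nat \<Rightarrow> int"
    assume \<gamma>: "(\<forall>i>n div 2. \<gamma> i = 0) \<and> H_poly P = (\<Sum>j\<le>n div 2. of_int (\<gamma> j) * gamma_term n j)"
    have "(\<Sum>j\<le>n div 2. of_int (\<gamma> j) * gamma_term n j) = (\<Sum>j\<le>n div 2. of_int (c j) * gamma_term n j)"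
      using conjunct2[OF \<gamma>, symmetric] H by (rule trans)
    then have "\<gamma> j = c j" if "j \<le> n div 2" for j
      using that by (rule gamma_coefficients_unique)
    then show "\<gamma> = ?c" using conjunct1[OF \<gamma>] by (auto simp: fun_eq_iff)
  qed
  then show ?thesis using i by simp
qed

lemma h_coeff_gamma_nonneg:
  assumes "gamma_nonneg n p" "i \<le> n"
  shows "0 \<le> h_coeff n p i"
  using assms(1)
proof (cases rule: gamma_nonneg_expand)
  case (1 c)
  then show ?thesis
    unfolding 1(2) h_coeff_expand using assms(2)
    by (intro sum_nonneg mult_nonneg_nonneg) (auto simp: h_coeff_gamma_term)
qed

text \<open>
  Up to the middle the binomial coefficients of \<open>(\<alpha> + t)\<^sup>n\<^sup>-\<^sup>2\<^sup>j\<close> increase, and the factor \<open>(\<alpha> t)\<^sup>j\<close>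
  keeps the middle in place.
\<close>

lemma h_coeff_gamma_increasing:
  assumes "gamma_nonneg n p" "Suc i \<le> n div 2"
  shows "h_coeff n p i \<le> h_coeff n p (Suc i)"
  using assms(1)
proof (cases rule: gamma_nonneg_expand)
  case (1 c)
  have "h_coeff n (gamma_term n j) i \<le> h_coeff n (gamma_term n j) (Suc i)" if "j \<le> n div 2" for j
    using that assms(2) by (auto simp: h_coeff_gamma_term intro!: binomial_mono)
  then show ?thesis
    unfolding 1(2) h_coeff_expand using 1(1) by (intro sum_mono mult_left_mono) auto
qed

definition coeffs_nonneg :: "int poly poly \<Rightarrow> bool" where
  "coeffs_nonneg p \<longleftrightarrow> (\<forall>a b. 0 \<le> coeff2 p a b)"

lemma coeffs_nonneg_add: "coeffs_nonneg p \<Longrightarrow> coeffs_nonneg q \<Longrightarrow> coeffs_nonneg (p + q)"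
  by (simp add: coeffs_nonneg_def coeff2_add)

lemma coeffs_nonneg_mult: "coeffs_nonneg p \<Longrightarrow> coeffs_nonneg q \<Longrightarrow> coeffs_nonneg (p * q)"
  unfolding coeffs_nonneg_def coeff2_def
  by (auto simp: coeff_mult coeff_sum intro!: sum_nonneg mult_nonneg_nonneg)

lemma coeffs_nonneg_power: "coeffs_nonneg p \<Longrightarrow> coeffs_nonneg (p ^ k)"
proof (induction k)
  case 0
  then show ?case using coeff2_monomial[of 0 0] by (simp add: coeffs_nonneg_def)
next
  case (Suc k)
  then show ?case by (simp add: coeffs_nonneg_mult)
qed

lemma coeffs_nonneg_vars: "coeffs_nonneg var_\<alpha>" "coeffs_nonneg var_t"
  using coeff2_monomial[of 1 0] coeff2_monomial[of 0 1] by (simp_all add: coeffs_nonneg_def)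

lemma pcompose_power: "pcompose (p ^ k) q = pcompose p q ^ k" for p q :: "'r::comm_semiring_1 poly"
  by (induction k) (simp_all add: pcompose_mult pcompose_1)

lemma pcompose_vars: "pcompose var_\<alpha> q = q" "pcompose var_t q = var_t"
  by (simp_all add: var_\<alpha>_def var_t_def pcompose_pCons)

text \<open>
  The F-polynomial arises from the H-polynomial by substituting \<open>\<alpha> + t\<close> for \<open>\<alpha>\<close>, and this
  substitution turns the generators into polynomials with nonnegative coefficients.
\<close>

lemma coeffs_nonneg_pcompose:
  assumes "gamma_nonneg n p"
  shows "coeffs_nonneg (pcompose p (var_\<alpha> + var_t))"
  using assms
proof (induction rule: gamma_nonneg.induct)
  case gamma_nonneg_0
  then show ?case by (simp add: coeffs_nonneg_def coeff2_0)
next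
  case (gamma_nonneg_add_term p i)
  have "coeffs_nonneg (pcompose (gamma_term n i) (var_\<alpha> + var_t))"
    unfolding gamma_term_def pcompose_mult pcompose_power pcompose_add pcompose_vars
    by (intro coeffs_nonneg_mult coeffs_nonneg_power coeffs_nonneg_add coeffs_nonneg_vars)
  then show ?case using gamma_nonneg_add_term.IH by (simp add: pcompose_add coeffs_nonneg_add)
qed

lemma f_num_eq_coeff2:
  assumes "i \<le> poly_dim P"
  shows "int (f_num P i) = coeff2 (pcompose (H_poly P) (var_\<alpha> + var_t)) i (poly_dim P - i)"
proof -
  have "pcompose (H_poly P) (var_\<alpha> + var_t) = pcompose (F_poly P) (pcompose (var_\<alpha> - var_t) (var_\<alpha> + var_t))"
    unfolding H_poly_def by (simp add: pcompose_assoc)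
  also have "pcompose (var_\<alpha> - var_t) (var_\<alpha> + var_t) = pcompose var_\<alpha> var_\<alpha>"
    by (simp add: pcompose_diff pcompose_vars)
  also have "pcompose (F_poly P) (pcompose var_\<alpha> var_\<alpha>) = F_poly P"
    unfolding pcompose_vars by (simp add: var_\<alpha>_def)
  finally have "coeff2 (pcompose (H_poly P) (var_\<alpha> + var_t)) i (poly_dim P - i) =
      (\<Sum>k\<le>poly_dim P. int (f_num P k) * (if i = k \<and> poly_dim P - i = poly_dim P - k then 1 else 0))"
    by (simp add: F_poly_def coeff2_sum coeff2_of_nat_mult coeff2_monomial mult.assoc)
  also have "\<dots> = (\<Sum>k\<le>poly_dim P. if k = i then int (f_num P k) else 0)"
    by (intro sum.cong) auto
  also have "\<dots> = int (f_num P i)" using assms by simp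
  finally show ?thesis by simp
qed

text \<open>
  All four kinds of numbers are linear in the H-polynomial and nonnegative on the cone
  \<open>gamma_nonneg\<close>, apart from \<open>g\<^sub>0\<close>, which is always 1.
\<close>

theorem face_numbers_mono:
  assumes dim: "poly_dim P = n" "poly_dim Q = n"
    and P: "gamma_nonneg n (H_poly P)" and PQ: "gamma_nonneg n (H_poly Q - H_poly P)"
  shows "i \<le> n div 2 \<Longrightarrow> gamma_num P i \<le> gamma_num Q i"
    and "i \<le> n div 2 \<Longrightarrow> g_num P i \<le> g_num Q i"
    and "i \<le> n \<Longrightarrow> h_num P i \<le> h_num Q i"
    and "i \<le> n \<Longrightarrow> f_num P i \<le> f_num Q i"
proof -
  have h: "h_num P k = h_coeff n (H_poly P) k" "h_num Q k = h_coeff n (H_poly Q) k" for k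
    by (simp_all add: h_num_def h_coeff_def coeff2_def dim)
  have diff: "h_coeff n (H_poly Q - H_poly P) k = h_num Q k - h_num P k" for k
    by (simp add: h h_coeff_def coeff2_diff)
  show "gamma_num P i \<le> gamma_num Q i" if i: "i \<le> n div 2"
  proof -
    obtain c where c: "\<And>j. 0 \<le> c j" "H_poly P = (\<Sum>j\<le>n div 2. of_int (c j) * gamma_term n j)"
      by (rule gamma_nonneg_expand[OF P]) (rule that)
    obtain d where d: "\<And>j. 0 \<le> d j" "H_poly Q - H_poly P = (\<Sum>j\<le>n div 2. of_int (d j) * gamma_term n j)"
      by (rule gamma_nonneg_expand[OF PQ]) (rule that)
    have "H_poly Q = H_poly P + (H_poly Q - H_poly P)" by simp
    also have "\<dots> = (\<Sum>j\<le>n div 2. of_int (c j + d j) * gamma_term n j)"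
      unfolding d(2) unfolding c(2) by (simp add: sum.distrib distrib_right)
    finally have "gamma_num Q i = c i + d i" by (rule gamma_num_eq[OF dim(2) _ i])
    moreover have "gamma_num P i = c i" using c(2) by (rule gamma_num_eq[OF dim(1) _ i])
    ultimately show ?thesis using d(1)[of i] by simp
  qed
  show "g_num P i \<le> g_num Q i" if i: "i \<le> n div 2"
  proof (cases i)
    case 0
    then show ?thesis by simp
  next
    case (Suc k)
    then show ?thesis using h_coeff_gamma_increasing[OF PQ, of k] i by (simp add: diff)
  qed
  show "h_num P i \<le> h_num Q i" if "i \<le> n"
    using h_coeff_gamma_nonneg[OF PQ that] by (simp add: diff)
  show "f_num P i \<le> f_num Q i" if "i \<le> n"
  proof -
    have "0 \<le> coeff2 (pcompose (H_poly Q - H_poly P) (var_\<alpha> + var_t)) i (n - i)"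
      using coeffs_nonneg_pcompose[OF PQ] by (simp add: coeffs_nonneg_def)
    then have "int (f_num P i) \<le> int (f_num Q i)"
      using f_num_eq_coeff2[of i P] f_num_eq_coeff2[of i Q] that
      by (simp add: dim pcompose_diff coeff2_diff)
    then show ?thesis by simp
  qed
qed

section \<open>Building sets and the face polynomial\<close>

lemma rtrancl_on_iff: "(a, b) \<in> rtrancl_on S R \<longleftrightarrow> a \<in> S \<and> (a, b) \<in> (Restr R S)\<^sup>*"
proof
  assume "(a, b) \<in> rtrancl_on S R"
  then show "a \<in> S \<and> (a, b) \<in> (Restr R S)\<^sup>*"
    by (induction rule: rtrancl_on_induct) (auto intro: rtrancl.rtrancl_into_rtrancl)
next
  assume *: "a \<in> S \<and> (a, b) \<in> (Restr R S)\<^sup>*"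
  then have "(a, b) \<in> (Restr R S)\<^sup>*" by simp
  then show "(a, b) \<in> rtrancl_on S R"
    by (induction rule: rtrancl_induct) (use * in \<open>auto intro: rtrancl_on_into_rtrancl_on\<close>)
qed

lemma connected_induce_iff_linked:
  assumes "sym (parcs G)"
  shows "Digraph_Component.connected (with_proj G \<restriction> S) \<longleftrightarrow> S \<noteq> {} \<and> linked (parcs G) S"
proof -
  have arcs: "parcs (mk_symmetric (with_proj G \<restriction> S)) = Restr (parcs G) S"
    "pverts (mk_symmetric (with_proj G \<restriction> S)) = S"
    using assms by (auto simp: mk_symmetric_def induce_subgraph_def dest: symD)
  have "Restr (Restr (parcs G) S) S = Restr (parcs G) S" by auto
  then show ?thesis
    unfolding Digraph_Component.connected_def strongly_connected_def reachable_def linked_def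
    by (auto simp: arcs rtrancl_on_iff)
qed

lemma (in graph_polytope) graph_associahedron_eq:
  assumes "pverts G = V" "parcs G = E"
  shows "graph_associahedron e G = associahedron"
proof -
  have "graphical_building_set G = tubes"
    using assms sym_E connected_induce_iff_linked[of G]
    by (auto simp: graphical_building_set_def tubes_def)
  then show ?thesis by (simp add: graph_associahedron_def associahedron_def)
qed

text \<open>
  The whole polytope is the face of the zero functional, whose preorder on a connected graph has
  a single block.
\<close>

lemma (in graph_polytope) poly_dim_associahedron:
  assumes "linked E V" "V \<noteq> {}"
  shows "poly_dim associahedron = card V - 1"
proof -
  have "{j\<in>V. \<forall>k\<in>V. weight 0 k \<le> weight 0 j} = V" by (auto simp: weight_def)
  then have "facial_preorder E (weight 0) V = V \<times> V"
    using facial_preorder_top[OF assms(1), of "weight 0"] by (simp add: facial_preorder_def)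
  then have "blocks (facial_preorder E (weight 0) V) V = {V}"
    using assms(2) by (auto simp: blocks_def quotient_def)
  moreover have "height 0 S = 0" if "S \<in> tubes" for S
  proof -
    have "weight 0 ` S = {0}" using tubeD[OF that] by (auto simp: weight_def)
    then show ?thesis by (simp add: height_def)
  qed
  then have "face_in 0 = associahedron" by (simp add: face_in_def)
  ultimately show ?thesis using aff_dim_face_in[of 0] by (simp add: poly_dim_def)
qed

text \<open>
  A preorder with \<open>k\<close> blocks contributes \<open>\<alpha>\<close> to the power \<open>|V| - k\<close>, and the remaining degree in
  the dimension \<open>|V| - 1\<close> is \<open>k - 1\<close>.
\<close>

lemma (in graph_polytope) F_poly_associahedron:
  assumes "linked E V" "V \<noteq> {}"
  shows "F_poly associahedron = h_sum var_t var_\<alpha> E V"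
proof -
  let ?C = "facial_preorders E V"
  let ?d = "\<lambda>c. card V - card (blocks c V)"
  let ?n = "card V - 1"
  let ?h = "\<lambda>c. var_t ^ (card (blocks c V) - 1) * var_\<alpha> ^ ?d c"
  have "F_poly associahedron = (\<Sum>i\<le>?n. of_nat (card {c\<in>?C. ?d c = i}) * var_\<alpha> ^ i * var_t ^ (?n - i))"
    by (simp add: F_poly_def poly_dim_associahedron[OF assms] f_num_associahedron)
  also have "\<dots> = (\<Sum>i\<le>?n. \<Sum>c\<in>{c\<in>?C. ?d c = i}. ?h c)"
  proof (rule sum.cong[OF refl])
    fix i assume "i \<in> {..?n}"
    have "?h c = var_\<alpha> ^ i * var_t ^ (?n - i)" if "?d c = i" for c
    proof -
      have "?n - i = card (blocks c V) - 1"
        using that card_blocks_le[OF finite_V, of c] card_blocks_pos[OF finite_V assms(2), of c] by simp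
      then show ?thesis using that by (simp add: mult.commute)
    qed
    then have "(\<Sum>c\<in>{c\<in>?C. ?d c = i}. ?h c) = (\<Sum>c\<in>{c\<in>?C. ?d c = i}. var_\<alpha> ^ i * var_t ^ (?n - i))"
      by (intro sum.cong refl) blast
    then show "of_nat (card {c\<in>?C. ?d c = i}) * var_\<alpha> ^ i * var_t ^ (?n - i) = (\<Sum>c\<in>{c\<in>?C. ?d c = i}. ?h c)"
      by (simp only: sum_constant mult.assoc)
  qed
  also have "\<dots> = (\<Sum>c\<in>?C. ?h c)"
  proof (rule sum.group)
    show "?d ` ?C \<subseteq> {..?n}" using card_blocks_pos[OF finite_V assms(2)] by (auto intro: diff_le_mono2 simp: Suc_le_eq)
  qed (use finite_facial_preorders[OF finite_V] in auto)
  finally show ?thesis by (simp add: h_sum_def)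
qed

lemma (in graph_polytope) H_poly_associahedron:
  assumes "linked E V" "V \<noteq> {}"
  shows "H_poly associahedron = h_polynomial E V"
  unfolding H_poly_def F_poly_associahedron[OF assms] h_sum_def
  by (simp add: pcompose_sum pcompose_mult pcompose_power pcompose_vars)

section \<open>Hamiltonian graphs contain a relabelled cycle graph\<close>

lemma linked_image:
  assumes "linked E S"
  shows "linked (map_prod f f ` E) (f ` S)"
proof -
  have "(f a, f b) \<in> (Restr (map_prod f f ` E) (f ` S))\<^sup>*" if "(a, b) \<in> (Restr E S)\<^sup>*" for a b
    using that
  proof (induction rule: rtrancl_induct)
    case base
    then show ?case by simp
  next
    case (step b c)
    then have "(f b, f c) \<in> Restr (map_prod f f ` E) (f ` S)" by force
    then show ?case by (rule rtrancl.rtrancl_into_rtrancl[OF step.IH])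
  qed
  then show ?thesis using assms by (auto simp: linked_def)
qed

text \<open>
  Permuting the vertices of the graph and, inversely, the coordinates leaves every summand of the
  Minkowski sum in place. So a relabelled graph has the polytope of the original one, seen through
  other coordinates.
\<close>

lemma associahedron_relabel:
  assumes s: "bij_betw \<sigma> V V" and E: "E \<subseteq> V \<times> V"
    and gp: "graph_polytope e E V" "graph_polytope (e \<circ> inv_into V \<sigma>) (map_prod \<sigma> \<sigma> ` E) V"
  shows "graph_polytope.associahedron (e \<circ> inv_into V \<sigma>) (map_prod \<sigma> \<sigma> ` E) V =
    graph_polytope.associahedron e E V"
proof -
  let ?\<tau> = "inv_into V \<sigma>"
  let ?F = "map_prod \<sigma> \<sigma> ` E"
  have inv: "?\<tau> (\<sigma> x) = x" if "x \<in> V" for x using s that by (rule bij_betw_inv_into_left)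
  have inv': "\<sigma> (?\<tau> x) = x" if "x \<in> V" for x using s that by (rule bij_betw_inv_into_right)
  have undo: "map_prod ?\<tau> ?\<tau> ` ?F = E"
  proof -
    have "map_prod ?\<tau> ?\<tau> ` ?F = id ` E"
      unfolding image_image using E inv by (intro image_cong) auto
    then show ?thesis by simp
  qed
  have inv_im: "?\<tau> ` \<sigma> ` S = S" if "S \<subseteq> V" for S
    using that inv by (force simp: image_image)
  have inv_im': "\<sigma> ` ?\<tau> ` S = S" if "S \<subseteq> V" for S
    using that inv' by (force simp: image_image)
  have V: "\<sigma> ` V = V" "?\<tau> ` V = V"
    using bij_betw_imp_surj_on[OF s] bij_betw_imp_surj_on[OF bij_betw_inv_into[OF s]] by auto
  let ?T = "graph_polytope.tubes E V"
  let ?T' = "graph_polytope.tubes ?F V"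
  have bij: "bij_betw (\<lambda>S. \<sigma> ` S) ?T ?T'"
  proof (rule bij_betw_byWitness[where f' = "\<lambda>S. ?\<tau> ` S"])
    show "\<forall>S\<in>?T. ?\<tau> ` \<sigma> ` S = S" "\<forall>S\<in>?T'. \<sigma> ` ?\<tau> ` S = S"
      unfolding graph_polytope.tubes_def[OF gp(1)] graph_polytope.tubes_def[OF gp(2)]
      using inv_im inv_im' by auto
    show "(\<lambda>S. \<sigma> ` S) ` ?T \<subseteq> ?T'"
      unfolding graph_polytope.tubes_def[OF gp(1)] graph_polytope.tubes_def[OF gp(2)]
      using V(1) by (auto intro: linked_image)
    have "linked E (?\<tau> ` S)" if "linked ?F S" for S
      using linked_image[OF that, of ?\<tau>] unfolding undo .
    then show "(\<lambda>S. ?\<tau> ` S) ` ?T' \<subseteq> ?T"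
      unfolding graph_polytope.tubes_def[OF gp(1)] graph_polytope.tubes_def[OF gp(2)]
      using V(2) by blast
  qed
  have "(\<Sum>S\<in>?T'. convex hull ((e \<circ> ?\<tau>) ` S)) = (\<Sum>S\<in>?T. convex hull ((e \<circ> ?\<tau>) ` \<sigma> ` S))"
    by (rule sum.reindex_bij_betw[OF bij, symmetric])
  also have "\<dots> = (\<Sum>S\<in>?T. convex hull (e ` S))"
  proof (rule sum.cong[OF refl])
    fix S assume "S \<in> ?T"
    then have "S \<subseteq> V" unfolding graph_polytope.tubes_def[OF gp(1)] by blast
    then show "convex hull ((e \<circ> ?\<tau>) ` \<sigma> ` S) = convex hull (e ` S)"
      by (simp only: image_comp[symmetric] inv_im)
  qed
  finally show ?thesis
    unfolding graph_polytope.associahedron_def[OF gp(1)] graph_polytope.associahedron_def[OF gp(2)] .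
qed

text \<open>
  The heads of the arcs of a Hamiltonian cycle list the vertices without repetition; position \<open>k\<close>
  of this list is the image of the vertex \<open>k\<close> of the cycle graph.
\<close>

lemma hamiltonian_cycle_embeds:
  fixes \<Gamma> :: "nat pair_pre_digraph"
  assumes graph: "pair_graph \<Gamma>" "pverts \<Gamma> = {1..m}" and ham: "hamiltonian \<Gamma>"
  obtains \<sigma> where "bij_betw \<sigma> {1..m} {1..m}"
    "map_prod \<sigma> \<sigma> ` parcs (cycle_graph m) \<subseteq> parcs \<Gamma>"
proof -
  interpret pair_graph \<Gamma> by fact
  obtain p where p: "cycle p" "3 \<le> length p" "fst ` set p = {1..m}"
    using ham graph(2) unfolding hamiltonian_def by auto
  obtain u where u: "awalk u p u" "distinct (tl (pawalk_verts u p))" "p \<noteq> []"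
    using p(1) unfolding cycle_def by auto
  have arcs: "set p \<subseteq> parcs \<Gamma>" and cas: "pcas u p u" using u(1) unfolding awalk_def by auto
  have step: "fst (p ! i) = (if i = 0 then u else snd (p ! (i - 1)))" if "pcas u p v" "i < length p" for u v i p
    using that by (induction p arbitrary: u i) (auto simp: nth_Cons split: nat.splits)
  have last: "snd (last p) = v" if "pcas u p v" "p \<noteq> []" for u v p
    using that by (induction p arbitrary: u) auto
  have verts: "tl (pawalk_verts u p) = map snd p" if "pcas u p v" for u v p
  proof -
    have "pawalk_verts u p = u # map snd p" if "pcas u p v" for u
      using that by (induction p arbitrary: u) auto
    then show ?thesis using that by simp
  qed
  let ?w = "map snd p"
  have dist: "distinct ?w" using u(2) verts[OF cas] by simp
  have "set ?w \<subseteq> {1..m}" using arcs arc_snd_in_verts graph(2) by auto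
  moreover have "m \<le> length p"
  proof -
    have "m = card (fst ` set p)" unfolding p(3) by simp
    also have "\<dots> \<le> length p" using card_image_le[of "set p" fst] card_length[of p] by simp
    finally show ?thesis .
  qed
  moreover have "card (set ?w) = length p" using distinct_card[OF dist] by simp
  ultimately have w: "set ?w = {1..m}" "length p = m"
    using card_mono[of "{1..m}" "set ?w"] card_subset_eq[of "{1..m}" "set ?w"] by auto
  define \<sigma> where "\<sigma> = (\<lambda>k. ?w ! (k - 1))"
  have "bij_betw (\<lambda>k. k - 1) {1..m} {..<m}"
    by (rule bij_betw_byWitness[where f' = Suc]) auto
  moreover have "bij_betw ((!) ?w) {..<m} {1..m}"
    using bij_betw_nth[OF dist, of "{..<m}" "{1..m}"] w by simp
  ultimately have bij: "bij_betw \<sigma> {1..m} {1..m}"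
    unfolding \<sigma>_def using bij_betw_trans[of "\<lambda>k. k - 1" "{1..m}" "{..<m}" "(!) ?w" "{1..m}"]
    by (simp add: comp_def)
  have sym: "(b, a) \<in> parcs \<Gamma>" if "(a, b) \<in> parcs \<Gamma>" for a b
    using pair_sym_arcs that by (auto simp: symmetric_def dest: symD)
  have next_arc: "(\<sigma> i, \<sigma> (Suc i)) \<in> parcs \<Gamma>" if "1 \<le> i" "Suc i \<le> m" for i
  proof -
    have "p ! i \<in> parcs \<Gamma>" using arcs that w(2) by auto
    moreover have "p ! i = (snd (p ! (i - 1)), snd (p ! i))"
      using step[OF cas, of i] that w(2) by (simp add: prod_eq_iff)
    ultimately show ?thesis using that w(2) by (simp add: \<sigma>_def)
  qed
  have closing: "(\<sigma> m, \<sigma> 1) \<in> parcs \<Gamma>"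
  proof -
    have "p ! 0 \<in> parcs \<Gamma>" using arcs u(3) by auto
    moreover have "p ! 0 = (snd (p ! (m - 1)), snd (p ! 0))"
      using step[OF cas, of 0] last[OF cas u(3)] u(3) w(2) p(2) by (simp add: prod_eq_iff last_conv_nth)
    ultimately show ?thesis using u(3) w(2) p(2) by (simp add: \<sigma>_def)
  qed
  have "map_prod \<sigma> \<sigma> ` parcs (cycle_graph m) \<subseteq> parcs \<Gamma>"
  proof
    fix x assume "x \<in> map_prod \<sigma> \<sigma> ` parcs (cycle_graph m)"
    then obtain i j where x: "x = (\<sigma> i, \<sigma> j)" and "(i, j) \<in> parcs (cycle_graph m)" by auto
    then have "i \<in> {1..m}" "j \<in> {1..m}" "j = Suc i \<or> i = Suc j \<or> (i = 1 \<and> j = m) \<or> (i = m \<and> j = 1)"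
      by (auto simp: cycle_graph_def doubleton_eq_iff)
    then show "x \<in> parcs \<Gamma>"
      using next_arc sym closing by (auto simp: x)
  qed
  then show ?thesis using that bij by blast
qed

lemma linked_cycle_graph: "linked (parcs (cycle_graph m)) {1..m}"
proof -
  let ?R = "Restr (parcs (cycle_graph m)) {1..m}"
  have up: "(1, k) \<in> ?R\<^sup>* \<and> (k, 1) \<in> ?R\<^sup>*" if "1 \<le> k" "k \<le> m" for k
    using that
  proof (induction k rule: nat_induct_at_least)
    case base
    then show ?case by simp
  next
    case (Suc k)
    have "(k, Suc k) \<in> ?R" "(Suc k, k) \<in> ?R" using Suc by (auto simp: cycle_graph_def)
    then show ?case using Suc by (meson Suc_leD converse_rtrancl_into_rtrancl rtrancl.rtrancl_into_rtrancl)
  qed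
  then show ?thesis unfolding linked_def by (meson atLeastAtMost_iff rtrancl_trans)
qed

lemma cycle_graph_arcs: "parcs (cycle_graph m) \<subseteq> {1..m} \<times> {1..m}"
proof (rule subrelI)
  fix a b assume "(a, b) \<in> parcs (cycle_graph m)"
  then show "(a, b) \<in> {1..m} \<times> {1..m}"
    unfolding cycle_graph_def by (simp only: pair_pre_digraph.select_convs mem_Collect_eq case_prod_conv) blast
qed

lemma sym_cycle_graph: "sym (parcs (cycle_graph m))"
proof (rule symI)
  fix a b assume "(a, b) \<in> parcs (cycle_graph m)"
  moreover have "{a, b} = {b, a}" by (rule insert_commute)
  ultimately show "(b, a) \<in> parcs (cycle_graph m)"
    unfolding cycle_graph_def by (simp only: pair_pre_digraph.select_convs mem_Collect_eq case_prod_conv) blast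
qed

lemma sym_complete_graph: "sym (parcs (complete_graph m))"
  unfolding complete_graph_def sym_def by auto

lemma pair_graph_sym: "pair_graph \<Gamma> \<Longrightarrow> sym (parcs \<Gamma>)"
proof -
  assume "pair_graph \<Gamma>"
  then interpret pair_graph \<Gamma> .
  show ?thesis using pair_sym_arcs by (simp add: symmetric_def)
qed

lemma pair_graph_arcs_complete:
  assumes "pair_graph \<Gamma>" "pverts \<Gamma> = {1..m}"
  shows "parcs \<Gamma> \<subseteq> parcs (complete_graph m)"
proof -
  interpret pair_graph \<Gamma> by fact
  show ?thesis
  proof clarify
    fix a b assume "(a, b) \<in> parcs \<Gamma>"
    then show "(a, b) \<in> parcs (complete_graph m)"
      using arc_fst_in_verts[of "(a, b)"] arc_snd_in_verts[of "(a, b)"] pair_no_loops[of "(a, b)"] assms(2)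
      by (auto simp: complete_graph_def)
  qed
qed

theorem theorem6:
  fixes n :: nat
    and e :: "nat \<Rightarrow> 'a::euclidean_space"
    and \<Gamma> :: "nat pair_pre_digraph"
  assumes basis: "bij_betw e {1..n + 1} (Basis :: 'a set)"
    and graph: "pair_graph \<Gamma>" "pverts \<Gamma> = {1..n + 1}"
    and ham: "hamiltonian \<Gamma>"
  shows
    "(\<forall>i \<le> n div 2.
        gamma_num (cyclohedron e n) i \<le> gamma_num (graph_associahedron e \<Gamma>) i \<and>
        gamma_num (graph_associahedron e \<Gamma>) i \<le> gamma_num (permutohedron e n) i) \<and>
     (\<forall>i \<le> n div 2.
        g_num (cyclohedron e n) i \<le> g_num (graph_associahedron e \<Gamma>) i \<and>
        g_num (graph_associahedron e \<Gamma>) i \<le> g_num (permutohedron e n) i) \<and>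
     (\<forall>i \<le> n.
        h_num (cyclohedron e n) i \<le> h_num (graph_associahedron e \<Gamma>) i \<and>
        h_num (graph_associahedron e \<Gamma>) i \<le> h_num (permutohedron e n) i) \<and>
     (\<forall>i \<le> n.
        f_num (cyclohedron e n) i \<le> f_num (graph_associahedron e \<Gamma>) i \<and>
        f_num (graph_associahedron e \<Gamma>) i \<le> f_num (permutohedron e n) i)"
proof -
  let ?V = "{1..n + 1}"
  let ?C = "parcs (cycle_graph (n + 1))"
  let ?K = "parcs (complete_graph (n + 1))"
  let ?E = "parcs \<Gamma>"
  obtain \<sigma> where \<sigma>: "bij_betw \<sigma> ?V ?V" "map_prod \<sigma> \<sigma> ` ?C \<subseteq> ?E"
    using hamiltonian_cycle_embeds[OF graph ham] by blast
  let ?F = "map_prod \<sigma> \<sigma> ` ?C"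
  let ?e = "e \<circ> inv_into ?V \<sigma>"
  have V: "finite ?V" "?V \<noteq> {}" "card ?V - 1 = n" by auto
  have subC: "?C \<subseteq> ?V \<times> ?V" by (rule cycle_graph_arcs)
  have symC: "sym ?C" by (rule sym_cycle_graph)
  then have symF: "sym ?F" by (auto simp: sym_def)
  have symE: "sym ?E" using pair_graph_sym[OF graph(1)] .
  have symK: "sym ?K" by (rule sym_complete_graph)
  have EK: "?E \<subseteq> ?K" using pair_graph_arcs_complete[OF graph] .
  have linF: "linked ?F ?V"
    using linked_image[OF linked_cycle_graph, of \<sigma> "n + 1"] bij_betw_imp_surj_on[OF \<sigma>(1)] by simp
  have linE: "linked ?E ?V" using linked_mono[OF linF \<sigma>(2)] .
  have linK: "linked ?K ?V" using linked_mono[OF linE EK] .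
  have gpC: "graph_polytope e ?C ?V" using V basis symC by unfold_locales
  have gpE: "graph_polytope e ?E ?V" using V basis symE by unfold_locales
  have gpK: "graph_polytope e ?K ?V" using V basis symK by unfold_locales
  have "bij_betw ?e ?V Basis" using bij_betw_trans[OF bij_betw_inv_into[OF \<sigma>(1)] basis] .
  then have gpF: "graph_polytope ?e ?F ?V" using V symF by unfold_locales
  have "cyclohedron e n = graph_polytope.associahedron e ?C ?V"
    unfolding cyclohedron_def
    by (rule graph_polytope.graph_associahedron_eq[OF gpC]) (simp_all add: cycle_graph_def)
  also have "\<dots> = graph_polytope.associahedron ?e ?F ?V"
    by (rule associahedron_relabel[OF \<sigma>(1) subC gpC gpF, symmetric])
  finally have cyc: "cyclohedron e n = graph_polytope.associahedron ?e ?F ?V" .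
  have gam: "graph_associahedron e \<Gamma> = graph_polytope.associahedron e ?E ?V"
    using graph(2) by (intro graph_polytope.graph_associahedron_eq[OF gpE]) auto
  have perm: "permutohedron e n = graph_polytope.associahedron e ?K ?V"
    unfolding permutohedron_def
    by (rule graph_polytope.graph_associahedron_eq[OF gpK]) (simp_all add: complete_graph_def)
  have dim: "poly_dim (cyclohedron e n) = n" "poly_dim (graph_associahedron e \<Gamma>) = n"
      "poly_dim (permutohedron e n) = n"
    unfolding cyc gam perm using V
      graph_polytope.poly_dim_associahedron[OF gpF linF] graph_polytope.poly_dim_associahedron[OF gpE linE]
      graph_polytope.poly_dim_associahedron[OF gpK linK] by simp_all
  have H: "H_poly (cyclohedron e n) = h_polynomial ?F ?V"
      "H_poly (graph_associahedron e \<Gamma>) = h_polynomial ?E ?V"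
      "H_poly (permutohedron e n) = h_polynomial ?K ?V"
    unfolding cyc gam perm using V(2)
      graph_polytope.H_poly_associahedron[OF gpF linF] graph_polytope.H_poly_associahedron[OF gpE linE]
      graph_polytope.H_poly_associahedron[OF gpK linK] by simp_all
  have pos: "gamma_nonneg n (H_poly (cyclohedron e n))" "gamma_nonneg n (H_poly (graph_associahedron e \<Gamma>))"
    unfolding H using h_polynomial_gamma_nonneg[OF symF V(2,1) linF]
      h_polynomial_gamma_nonneg[OF symE V(2,1) linE] V(3) by simp_all
  have diff: "gamma_nonneg n (H_poly (graph_associahedron e \<Gamma>) - H_poly (cyclohedron e n))"
      "gamma_nonneg n (H_poly (permutohedron e n) - H_poly (graph_associahedron e \<Gamma>))"
    unfolding H using h_polynomial_mono[OF symF symE \<sigma>(2) V(1,2) linF]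
      h_polynomial_mono[OF symE symK EK V(1,2) linE] V(3) by simp_all
  show ?thesis
    using face_numbers_mono[OF dim(1,2) pos(1) diff(1)] face_numbers_mono[OF dim(2,3) pos(2) diff(2)]
    by blast
qed

end
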